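(* Let $(S_n)_{n\ge 0}$ be a transient random walk on a countable group $G$ started at the identity element $e$, and let $$\gamma = P(S_n\neq e,\ \forall n\ge 1)>0.$$ Suppose that $f:\mathbb{Z}_+\to\mathbb{R}$ with $f(0)=0$ satisfies $$\sum_{j=1}^\infty \frac{f(j)^2(1-\gamma)^j}{j}<\infty.$$ Then, as $n\to\infty$, $$\frac{1}{n}G_n(f)\to \gamma^2\sum_{j=1}^\infty f(j)(1-\gamma)^{j-1}$$ in $L^2$.
   Context: $G$ is a countable group (written multiplicatively) with identity $e$. The random walk is $S_0=e$ almost surely and $S_n=\xi_1\xi_2\cdots\xi_n$ for $n\ge 1$, where $(\xi_n)_{n\ge1}$ is a sequence of independent and identically distributed $G$-valued random variables. Transience means $P(S_n\ne e,\ \forall n\ge 1)>0$. $\mathbb{Z}_+=\{0,1,2,\dots\}$. The local time of $x\in G$ up to time $n\ge 0$ is $\ell(n,x)=\sum_{i=0}^{n}\mathbb{I}_{(S_i=x)}$, where $\mathbb{I}$ is the indicator. For $f:\mathbb{Z}_+\to\mathbb{R}$ with $f(0)=0$ and $n\ge 1$, $G_n(f)=\sum_{x\in G} f(\ell(n-1,x))$ (a sum with finitely many nonzero terms). Convention: $0^0=1$. *)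

theory Defs
  imports "HOL-Probability.Probability" "HOL-Algebra.Group"
begin

primrec ordered_product ::
  "('g, 'b) monoid_scheme \<Rightarrow> (nat \<Rightarrow> 'w \<Rightarrow> 'g) \<Rightarrow> nat \<Rightarrow> 'w \<Rightarrow> 'g" where
  "ordered_product G \<xi> 0 \<omega> = \<one>\<^bsub>G\<^esub>"
| "ordered_product G \<xi> (Suc n) \<omega> = ordered_product G \<xi> n \<omega> \<otimes>\<^bsub>G\<^esub> \<xi> (Suc n) \<omega>"

text \<open>The steps are indexed from 1; \<open>\<xi> 0\<close> is unconstrained and never used. The starting point
  equals the identity only almost surely.\<close>

locale random_walk = prob_space M + group G
  for M :: "'w measure" and G :: "('g, 'b) monoid_scheme" +
  fixes \<xi> :: "nat \<Rightarrow> 'w \<Rightarrow> 'g" and S :: "nat \<Rightarrow> 'w \<Rightarrow> 'g"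
  assumes countable_carrier: "countable (carrier G)"
    and steps_indep: "indep_vars (\<lambda>_. count_space (carrier G)) \<xi> {1..}"
    and steps_ident: "\<And>n. n \<ge> 1 \<Longrightarrow>
      distr M (count_space (carrier G)) (\<xi> n) = distr M (count_space (carrier G)) (\<xi> 1)"
    and start_measurable: "S 0 \<in> measurable M (count_space (carrier G))"
    and start: "AE \<omega> in M. S 0 \<omega> = \<one>\<^bsub>G\<^esub>"
    and walk: "\<And>n \<omega>. n \<ge> 1 \<Longrightarrow> \<omega> \<in> space M \<Longrightarrow> S n \<omega> = ordered_product G \<xi> n \<omega>"

definition escape_prob ::
  "'w measure \<Rightarrow> ('g, 'b) monoid_scheme \<Rightarrow> (nat \<Rightarrow> 'w \<Rightarrow> 'g) \<Rightarrow> real" where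
  "escape_prob M G S = measure M {\<omega> \<in> space M. \<forall>n\<ge>1. S n \<omega> \<noteq> \<one>\<^bsub>G\<^esub>}"

definition transient ::
  "'w measure \<Rightarrow> ('g, 'b) monoid_scheme \<Rightarrow> (nat \<Rightarrow> 'w \<Rightarrow> 'g) \<Rightarrow> bool" where
  "transient M G S \<longleftrightarrow> escape_prob M G S > 0"

definition local_time :: "(nat \<Rightarrow> 'w \<Rightarrow> 'g) \<Rightarrow> nat \<Rightarrow> 'g \<Rightarrow> 'w \<Rightarrow> nat" where
  "local_time S n x \<omega> = (\<Sum>i\<le>n. of_bool (S i \<omega> = x))"

text \<open>Meaningful for \<open>n \<ge> 1\<close> (natural subtraction truncates at 0). When \<open>f 0 = 0\<close> the sum
  has finite support, so \<open>infsum\<close> is the ordinary finite sum even if the group is infinite.\<close>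

definition local_time_functional ::
  "('g, 'b) monoid_scheme \<Rightarrow> (nat \<Rightarrow> 'w \<Rightarrow> 'g) \<Rightarrow> (nat \<Rightarrow> real) \<Rightarrow> nat \<Rightarrow> 'w \<Rightarrow> real" where
  "local_time_functional G S f n \<omega> =
     (\<Sum>\<^sub>\<infinity>x\<in>carrier G. f (local_time S (n - 1) x \<omega>))"

definition square_integrable :: "'w measure \<Rightarrow> ('w \<Rightarrow> real) \<Rightarrow> bool" where
  "square_integrable M X \<longleftrightarrow> X \<in> borel_measurable M \<and> integrable M (\<lambda>\<omega>. (X \<omega>)\<^sup>2)"

text \<open>Square integrability is required explicitly, since the Bochner integral of a
  non-integrable function is 0.\<close>

definition tendsto_L2 :: "'w measure \<Rightarrow> (nat \<Rightarrow> 'w \<Rightarrow> real) \<Rightarrow> ('w \<Rightarrow> real) \<Rightarrow> bool" where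
  "tendsto_L2 M X Y \<longleftrightarrow>
     (\<forall>n. square_integrable M (X n)) \<and> square_integrable M Y \<and>
     (\<lambda>n. \<integral>\<omega>. (X n \<omega> - Y \<omega>)\<^sup>2 \<partial>M) \<longlonglongrightarrow> 0"

end

theory Submission imports Defs
begin

text \<open>
  Let \<open>q = 1 - \<gamma>\<close> be the probability of ever returning. List the visits to a point
  from the last one backwards: the visit made at time \<open>i\<close> is followed by \<open>N\<^sub>i\<close> later visits
  to the same point before time \<open>n\<close>, and as \<open>i\<close> runs through the visits to a point with local time
  \<open>l\<close>, the number \<open>N\<^sub>i\<close> runs through \<open>0, ..., l - 1\<close>. Telescoping over the visits to each point
  gives
  \<open>G\<^sub>n(f) = (\<Sum>i<n. f (N\<^sub>i + 1) - f N\<^sub>i)\<close>,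
  so the sum over points becomes a sum over times whose summands look only into the future
  of the walk (\<open>sum_over_points_eq_sum_over_times\<close>).

  By the group structure \<open>N\<^sub>i\<close> is the number of returns to the identity of the walk driven by the
  steps after time \<open>i\<close>. Cutting at the first return shows that this number has tail
  \<open>P(N \<ge> a) \<le> q ^ a\<close> over any finite horizon, with equality in the limit
  (\<open>returns_tail_le\<close>, \<open>returns_tail_tendsto\<close>). Since returns within a bounded horizon depend on
  a bounded number of steps, far apart times are almost independent, and the fraction of times
  \<open>i < n\<close> with \<open>N\<^sub>i \<ge> a\<close> tends to \<open>q ^ a\<close> in \<open>L\<^sup>2\<close> by Chebyshev's variance computation
  (\<open>return_level_variance_le\<close>). For finitely supported \<open>f\<close> the functional is a finite linear
  combination of these fractions, and
  \<open>q ^ j - 2 * q ^ (j + 1) + q ^ (j + 2) = \<gamma>\<^sup>2 * q ^ j\<close> gives the limit.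

  A general \<open>f\<close> is truncated. The error is controlled by Cauchy-Schwarz with the local times as
  weights: the local times add up to \<open>n\<close>, so \<open>G\<^sub>n(f)\<^sup>2 \<le> n * G\<^sub>n(f\<^sup>2 / id)\<close>, and the same telescoping
  bounds the right-hand side by \<open>n * (\<Sum>i<n. f (N\<^sub>i + 1)\<^sup>2 / (N\<^sub>i + 1))\<close>. With the geometric tail
  this yields \<open>E (G\<^sub>n(f) / n)\<^sup>2 \<le> (\<Sum>j. f (j + 1)\<^sup>2 / (j + 1) * q ^ j)\<close>
  (\<open>walk_functional_second_moment_le\<close>), and it is here that the summability hypothesis enters:
  its tails bound the truncation error uniformly in \<open>n\<close>.
\<close>

section \<open>Counting visits by points and by times\<close>

definition later_visits :: "(nat \<Rightarrow> 'a) \<Rightarrow> nat \<Rightarrow> nat \<Rightarrow> nat" where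
  "later_visits s n i = card {k. i < k \<and> k < n \<and> s k = s i}"

text \<open>Adding the visit at the earliest time \<open>l\<close> raises the count of the single point \<open>s l\<close> from its
  number of later visits by one and leaves all the later terms unchanged; hence the induction
  runs downwards on the starting time.\<close>

lemma sum_over_points_eq_sum_over_times:
  fixes f :: "nat \<Rightarrow> real"
  assumes X: "finite X" "s ` {..<n} \<subseteq> X" and f0: "f 0 = 0"
  shows "(\<Sum>x\<in>X. f (card {k. k < n \<and> s k = x})) =
         (\<Sum>i<n. f (Suc (later_visits s n i)) - f (later_visits s n i))"
proof -
  have "(\<Sum>x\<in>X. f (card {k. l \<le> k \<and> k < n \<and> s k = x})) =
         (\<Sum>i=l..<n. f (Suc (later_visits s n i)) - f (later_visits s n i))" if "l \<le> n" for l
    using that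
  proof (induction rule: inc_induct)
    case base
    have "{k. n \<le> k \<and> k < n \<and> s k = x} = {}" for x by auto
    then show ?case by (simp only: card.empty f0 sum.neutral_const) simp
  next
    case (step l)
    let ?c = "\<lambda>l x. card {k. l \<le> k \<and> k < n \<and> s k = x}"
    have lX: "s l \<in> X" using step X by auto
    have eq: "{k. l \<le> k \<and> k < n \<and> s k = x} =
        (if x = s l then insert l {k. Suc l \<le> k \<and> k < n \<and> s k = x}
         else {k. Suc l \<le> k \<and> k < n \<and> s k = x})" for x
      using step by (auto simp: Suc_le_eq le_less)
    have c1: "?c l (s l) = Suc (later_visits s n l)"
      by (subst eq) (simp add: later_visits_def Suc_le_eq)
    have c2: "?c (Suc l) (s l) = later_visits s n l"
      by (simp add: later_visits_def Suc_le_eq)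
    have c3: "?c l x = ?c (Suc l) x" if "x \<noteq> s l" for x
      using that by (subst eq) simp
    have "(\<Sum>x\<in>X. f (?c l x)) = f (?c l (s l)) + (\<Sum>x\<in>X - {s l}. f (?c l x))"
      by (rule sum.remove[OF X(1) lX])
    also have "(\<Sum>x\<in>X - {s l}. f (?c l x)) = (\<Sum>x\<in>X - {s l}. f (?c (Suc l) x))"
      by (intro sum.cong refl) (use c3 in auto)
    also have "f (?c l (s l)) + \<dots> =
        f (Suc (later_visits s n l)) - f (later_visits s n l) + (\<Sum>x\<in>X. f (?c (Suc l) x))"
      by (subst sum.remove[OF X(1) lX]) (simp only: c1 c2)
    finally show ?case
      using step by (simp add: sum.atLeast_Suc_lessThan)
  qed
  from this[of 0] show ?thesis by (simp add: atLeast0LessThan)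
qed

text \<open>Cauchy-Schwarz over the visited points with the visit counts \<open>c x\<close> as weights, which sum to \<open>n\<close>.
  The weighted sum of \<open>f\<^sup>2 / id\<close> is turned back into a sum over times by the same telescoping, where the
  subtracted terms are nonnegative and can be dropped.\<close>

lemma sum_over_points_squared_le:
  fixes f :: "nat \<Rightarrow> real"
  assumes f0: "f 0 = 0"
  shows "(\<Sum>i<n. f (Suc (later_visits s n i)) - f (later_visits s n i))\<^sup>2 \<le>
         real n * (\<Sum>i<n. (f (Suc (later_visits s n i)))\<^sup>2 / real (Suc (later_visits s n i)))"
proof -
  define X where "X = s ` {..<n}"
  define c where "c = (\<lambda>x. card {k. k < n \<and> s k = x})"
  define F where "F = (\<lambda>j. (f j)\<^sup>2 / real j)"
  have X: "finite X" "s ` {..<n} \<subseteq> X" by (auto simp: X_def)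
  have transfer: "(\<Sum>x\<in>X. g (c x)) =
      (\<Sum>i<n. g (Suc (later_visits s n i)) - g (later_visits s n i))" if "g 0 = 0" for g :: "nat \<Rightarrow> real"
    unfolding c_def by (rule sum_over_points_eq_sum_over_times[where f = g and s = s and n = n, OF X that])
  have sqrt_mult: "sqrt (real j) * (f j / sqrt (real j)) = f j" for j
    using f0 by (cases "j = 0") auto
  have "(\<Sum>i<n. f (Suc (later_visits s n i)) - f (later_visits s n i))\<^sup>2 =
        (\<Sum>x\<in>X. sqrt (real (c x)) * (f (c x) / sqrt (real (c x))))\<^sup>2"
    by (simp only: sqrt_mult transfer[of f, OF f0])
  also have "\<dots> \<le> (\<Sum>x\<in>X. (sqrt (real (c x)))\<^sup>2) * (\<Sum>x\<in>X. (f (c x) / sqrt (real (c x)))\<^sup>2)"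
    by (rule Cauchy_Schwarz_ineq_sum)
  also have "(\<Sum>x\<in>X. (sqrt (real (c x)))\<^sup>2) = real n"
    using transfer[of real] by simp
  also have "(\<Sum>x\<in>X. (f (c x) / sqrt (real (c x)))\<^sup>2) = (\<Sum>x\<in>X. F (c x))"
    by (simp add: F_def power_divide)
  also have "\<dots> = (\<Sum>i<n. F (Suc (later_visits s n i)) - F (later_visits s n i))"
    by (rule transfer) (simp add: F_def)
  also have "\<dots> \<le> (\<Sum>i<n. F (Suc (later_visits s n i)))"
    by (intro sum_mono) (simp add: F_def)
  finally show ?thesis by (simp add: F_def mult_left_mono)
qed

section \<open>Returns of a product sequence to the identity\<close>

text \<open>Evaluating the ordered product on a bare sequence of group elements allows events on finitely many
  steps to be written as predicates on sequences.\<close>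

abbreviation partial_product :: "('g, 'b) monoid_scheme \<Rightarrow> (nat \<Rightarrow> 'g) \<Rightarrow> nat \<Rightarrow> 'g" where
  "partial_product G x n \<equiv> ordered_product G (\<lambda>i x. x i) n x"

lemma ordered_product_eq_partial_product:
  "ordered_product G \<xi> n \<omega> = partial_product G (\<lambda>i. \<xi> i \<omega>) n"
  by (induction n) auto

lemma partial_product_cong:
  "(\<And>i. 1 \<le> i \<Longrightarrow> i \<le> n \<Longrightarrow> x i = y i) \<Longrightarrow> partial_product G x n = partial_product G y n"
  by (induction n) auto

lemma (in group) partial_product_closed:
  "(\<And>i. 1 \<le> i \<Longrightarrow> i \<le> n \<Longrightarrow> x i \<in> carrier G) \<Longrightarrow> partial_product G x n \<in> carrier G"
  by (induction n) auto

lemma (in group) partial_product_add: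
  assumes "\<And>i. 1 \<le> i \<Longrightarrow> x i \<in> carrier G"
  shows "partial_product G x (s + n) =
    partial_product G x s \<otimes> partial_product G (\<lambda>i. x (s + i)) n"
proof (induction n)
  case 0
  then show ?case using assms by (simp add: partial_product_closed)
next
  case (Suc n)
  then show ?case
    using assms by (simp add: partial_product_closed m_assoc)
qed

definition return_count :: "('g, 'b) monoid_scheme \<Rightarrow> (nat \<Rightarrow> 'g) \<Rightarrow> nat \<Rightarrow> nat" where
  "return_count G x n = card {k\<in>{1..n}. partial_product G x k = \<one>\<^bsub>G\<^esub>}"

definition first_return_at :: "('g, 'b) monoid_scheme \<Rightarrow> (nat \<Rightarrow> 'g) \<Rightarrow> nat \<Rightarrow> bool" where
  "first_return_at G x k \<longleftrightarrow> partial_product G x k = \<one>\<^bsub>G\<^esub> \<and>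
     (\<forall>l\<in>{1..<k}. partial_product G x l \<noteq> \<one>\<^bsub>G\<^esub>)"

lemma return_count_mono: "m \<le> n \<Longrightarrow> return_count G x m \<le> return_count G x n"
  unfolding return_count_def by (intro card_mono) auto

lemma return_count_le: "return_count G x n \<le> n"
  unfolding return_count_def by (rule order.trans[OF card_mono[of "{1..n}"]]) auto

lemma return_count_cong:
  assumes "\<And>i. 1 \<le> i \<Longrightarrow> i \<le> n \<Longrightarrow> x i = y i"
  shows "return_count G x n = return_count G y n"
proof -
  have "partial_product G x k = partial_product G y k" if "k \<le> n" for k
    using that assms by (intro partial_product_cong) auto
  then show ?thesis unfolding return_count_def by (intro arg_cong[of _ _ card]) auto
qed

lemma first_return_at_cong:
  assumes "\<And>i. 1 \<le> i \<Longrightarrow> i \<le> k \<Longrightarrow> x i = y i"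
  shows "first_return_at G x k \<longleftrightarrow> first_return_at G y k"
proof -
  have "partial_product G x l = partial_product G y l" if "l \<le> k" for l
    using that assms by (intro partial_product_cong) auto
  then show ?thesis unfolding first_return_at_def by auto
qed

text \<open>At a return the partial product is the identity, so what follows is a fresh walk driven by
  the remaining steps.\<close>

lemma (in group) return_count_after_first_return:
  assumes x: "\<And>i. 1 \<le> i \<Longrightarrow> x i \<in> carrier G"
    and k: "1 \<le> k" "k \<le> m" "first_return_at G x k"
  shows "return_count G x m = Suc (return_count G (\<lambda>i. x (k + i)) (m - k))"
proof -
  let ?R = "{j\<in>{1..m - k}. partial_product G (\<lambda>i. x (k + i)) j = \<one>}"
  have add: "partial_product G x (k + j) = partial_product G (\<lambda>i. x (k + i)) j" for j
    using x k by (subst partial_product_add) (auto simp: first_return_at_def partial_product_closed)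
  have "{j\<in>{1..m}. partial_product G x j = \<one>} = insert k ((+) k ` ?R)"
  proof (intro Set.set_eqI iffI)
    fix j assume j: "j \<in> {j\<in>{1..m}. partial_product G x j = \<one>}"
    show "j \<in> insert k ((+) k ` ?R)"
    proof (cases "j \<le> k")
      case True
      with j k(3) show ?thesis by (auto simp: first_return_at_def le_less)
    next
      case False
      then have "j = k + (j - k)" "j - k \<in> ?R"
        using j add[of "j - k"] by auto
      then show ?thesis by blast
    qed
  next
    fix j assume "j \<in> insert k ((+) k ` ?R)"
    then show "j \<in> {j\<in>{1..m}. partial_product G x j = \<one>}"
      using k by (auto simp: add first_return_at_def)
  qed
  moreover have "card (insert k ((+) k ` ?R)) = Suc (card ?R)"
    by (subst card_insert_disjoint) (auto simp: card_image)
  ultimately show ?thesis by (simp add: return_count_def)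
qed

lemma return_count_pos_iff_first_return:
  "1 \<le> return_count G x m \<longleftrightarrow> (\<exists>k\<in>{1..m}. first_return_at G x k)"
proof
  assume "1 \<le> return_count G x m"
  then have "{k\<in>{1..m}. partial_product G x k = \<one>\<^bsub>G\<^esub>} \<noteq> {}"
    unfolding return_count_def by (metis card.empty not_one_le_zero)
  then have ex: "\<exists>k. k \<in> {1..m} \<and> partial_product G x k = \<one>\<^bsub>G\<^esub>" by blast
  define k where "k = (LEAST k. k \<in> {1..m} \<and> partial_product G x k = \<one>\<^bsub>G\<^esub>)"
  have "k \<in> {1..m}" "partial_product G x k = \<one>\<^bsub>G\<^esub>"
    using LeastI_ex[OF ex] by (auto simp: k_def)
  moreover have "partial_product G x l \<noteq> \<one>\<^bsub>G\<^esub>" if "l \<in> {1..<k}" for l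
    using not_less_Least[of l "\<lambda>k. k \<in> {1..m} \<and> partial_product G x k = \<one>\<^bsub>G\<^esub>"] that
      \<open>k \<in> {1..m}\<close> by (auto simp: k_def)
  ultimately show "\<exists>k\<in>{1..m}. first_return_at G x k" by (auto simp: first_return_at_def)
next
  assume "\<exists>k\<in>{1..m}. first_return_at G x k"
  then have "{k\<in>{1..m}. partial_product G x k = \<one>\<^bsub>G\<^esub>} \<noteq> {}"
    by (auto simp: first_return_at_def)
  then show "1 \<le> return_count G x m"
    unfolding return_count_def by (simp add: Suc_le_eq card_gt_0_iff)
qed

lemma first_return_at_unique:
  "first_return_at G x k \<Longrightarrow> first_return_at G x l \<Longrightarrow> 1 \<le> k \<Longrightarrow> 1 \<le> l \<Longrightarrow> k = l"
  unfolding first_return_at_def by (metis atLeastLessThan_iff linorder_neqE_nat)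

section \<open>Finite blocks of independent steps\<close>

context random_walk
begin

definition step_block :: "nat \<Rightarrow> nat \<Rightarrow> 'w \<Rightarrow> nat \<Rightarrow> 'g" where
  "step_block s m \<omega> = (\<lambda>i\<in>{1..m}. \<xi> (s + i) \<omega>)"

lemma step_measurable: "1 \<le> i \<Longrightarrow> \<xi> i \<in> measurable M (count_space (carrier G))"
  using steps_indep unfolding indep_vars_def by auto

lemma step_in_carrier: "1 \<le> i \<Longrightarrow> \<omega> \<in> space M \<Longrightarrow> \<xi> i \<omega> \<in> carrier G"
  using measurable_space[OF step_measurable] by simp

lemma PiM_carrier_eq_count_space:
  "finite I \<Longrightarrow> PiM I (\<lambda>_. count_space (carrier G)) = count_space (I \<rightarrow>\<^sub>E carrier G)"
  by (rule count_space_PiM_finite) (auto simp: countable_carrier)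

lemma step_block_measurable:
  "step_block s m \<in> measurable M (PiM {1..m} (\<lambda>_. count_space (carrier G)))"
  unfolding step_block_def by (intro measurable_restrict step_measurable) auto

text \<open>The carrier is countable, so a finite block of steps takes values in a countable discrete
  space and every predicate on it is measurable.\<close>

lemma block_event_measurable: "{\<omega>\<in>space M. Q (step_block s m \<omega>)} \<in> events"
proof -
  have "step_block s m -` {x\<in>{1..m} \<rightarrow>\<^sub>E carrier G. Q x} \<inter> space M \<in> events"
    by (rule measurable_sets[OF step_block_measurable]) (auto simp: PiM_carrier_eq_count_space)
  also have "step_block s m -` {x\<in>{1..m} \<rightarrow>\<^sub>E carrier G. Q x} \<inter> space M =
      {\<omega>\<in>space M. Q (step_block s m \<omega>)}"
    by (auto simp: step_block_def step_in_carrier)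
  finally show ?thesis .
qed

text \<open>The law of a block does not depend on its position \<open>s\<close>, since the steps are independent and
  identically distributed.\<close>

lemma distr_step_block:
  assumes "1 \<le> m"
  shows "distr M (PiM {1..m} (\<lambda>_. count_space (carrier G))) (step_block s m) =
    PiM {1..m} (\<lambda>_. distr M (count_space (carrier G)) (\<xi> 1))"
proof -
  let ?N = "count_space (carrier G)" and ?I = "{s + 1..s + m}"
  let ?D = "distr M ?N (\<xi> 1)"
  have indep: "indep_vars (\<lambda>_. ?N) \<xi> ?I"
    by (rule indep_vars_subset[OF steps_indep]) auto
  have ne: "?I \<noteq> {}" using assms by simp
  have rv: "\<xi> i \<in> measurable M ?N" if "i \<in> ?I" for i
    by (rule step_measurable) (use that in simp)
  have "distr M (PiM ?I (\<lambda>_. ?N)) (\<lambda>\<omega>. \<lambda>i\<in>?I. \<xi> i \<omega>) = PiM ?I (\<lambda>i. distr M ?N (\<xi> i))"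
    using indep indep_vars_iff_distr_eq_PiM'[where M' = "\<lambda>_. ?N" and X = \<xi> and I = ?I, OF ne rv]
    by (rule iffD1[rotated])
  also have "\<dots> = PiM ?I (\<lambda>_. ?D)"
    by (intro PiM_cong refl steps_ident) simp
  finally have *: "distr M (PiM ?I (\<lambda>_. ?N)) (\<lambda>\<omega>. \<lambda>i\<in>?I. \<xi> i \<omega>) = PiM ?I (\<lambda>_. ?D)" .
  have sets_eq: "sets (PiM J (\<lambda>_. ?D)) = sets (PiM J (\<lambda>_. ?N))" for J :: "nat set"
    by (intro sets_PiM_cong) auto
  have "PiM {1..m} (\<lambda>_. ?D) =
      distr (PiM ?I (\<lambda>_. ?D)) (PiM {1..m} (\<lambda>_. ?D)) (\<lambda>\<omega>. \<lambda>n\<in>{1..m}. \<omega> (s + n))"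
    by (rule distr_PiM_reindex[symmetric])
       (auto intro!: prob_space_distr step_measurable simp: inj_on_def)
  also have "\<dots> = distr (PiM ?I (\<lambda>_. ?D)) (PiM {1..m} (\<lambda>_. ?N)) (\<lambda>\<omega>. \<lambda>n\<in>{1..m}. \<omega> (s + n))"
    by (intro distr_cong sets_eq refl)
  also have "\<dots> = distr M (PiM {1..m} (\<lambda>_. ?N))
      ((\<lambda>\<omega>. \<lambda>n\<in>{1..m}. \<omega> (s + n)) \<circ> (\<lambda>\<omega>. \<lambda>i\<in>?I. \<xi> i \<omega>))"
    unfolding *[symmetric]
    by (rule distr_distr)
       (auto intro!: measurable_restrict measurable_component_singleton step_measurable)
  also have "\<dots> = distr M (PiM {1..m} (\<lambda>_. ?N)) (step_block s m)"
    by (intro distr_cong refl) (auto simp: step_block_def restrict_def fun_eq_iff)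
  finally show ?thesis by simp
qed

lemma prob_block_shift:
  "prob {\<omega>\<in>space M. Q (step_block s m \<omega>)} = prob {\<omega>\<in>space M. Q (step_block 0 m \<omega>)}"
proof (cases "m = 0")
  case True
  then show ?thesis by (simp add: step_block_def restrict_def)
next
  case False
  have "prob {\<omega>\<in>space M. Q (step_block s m \<omega>)} =
    measure (PiM {1..m} (\<lambda>_. distr M (count_space (carrier G)) (\<xi> 1)))
      {x\<in>{1..m} \<rightarrow>\<^sub>E carrier G. Q x}" for s
  proof -
    have "prob {\<omega>\<in>space M. Q (step_block s m \<omega>)} =
      prob (step_block s m -` {x\<in>{1..m} \<rightarrow>\<^sub>E carrier G. Q x} \<inter> space M)"
      by (intro arg_cong[where f = prob]) (auto simp: step_block_def step_in_carrier)
    also have "\<dots> = measure (distr M (PiM {1..m} (\<lambda>_. count_space (carrier G))) (step_block s m))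
      {x\<in>{1..m} \<rightarrow>\<^sub>E carrier G. Q x}"
      by (rule measure_distr[symmetric, OF step_block_measurable])
         (auto simp: PiM_carrier_eq_count_space)
    also have "distr M (PiM {1..m} (\<lambda>_. count_space (carrier G))) (step_block s m) =
        PiM {1..m} (\<lambda>_. distr M (count_space (carrier G)) (\<xi> 1))"
      by (rule distr_step_block) (use False in simp)
    finally show ?thesis .
  qed
  from this[of s] this[of 0] show ?thesis by simp
qed

lemma prob_disjoint_blocks:
  assumes "s + k \<le> t"
  shows "prob {\<omega>\<in>space M. Q (step_block s k \<omega>) \<and> R (step_block t l \<omega>)} =
    prob {\<omega>\<in>space M. Q (step_block s k \<omega>)} * prob {\<omega>\<in>space M. R (step_block t l \<omega>)}"
proof -
  let ?N = "\<lambda>_::nat. count_space (carrier G)"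
  let ?sh = "\<lambda>s k x. \<lambda>i\<in>{1..k}. x (s + i)"
  have sh: "?sh s k \<in> measurable (PiM {s + 1..s + k} ?N) (PiM {1..k} ?N)" for s k :: nat
    by (auto intro!: measurable_restrict measurable_component_singleton)
  have "indep_var (PiM {s + 1..s + k} ?N) (\<lambda>\<omega>. restrict (\<lambda>i. \<xi> i \<omega>) {s + 1..s + k})
      (PiM {t + 1..t + l} ?N) (\<lambda>\<omega>. restrict (\<lambda>i. \<xi> i \<omega>) {t + 1..t + l})"
    by (rule indep_var_restrict[OF steps_indep]) (use assms in auto)
  from indep_var_compose[OF this sh sh]
  have "indep_var (PiM {1..k} ?N) (step_block s k) (PiM {1..l} ?N) (step_block t l)"
    by (simp add: step_block_def o_def restrict_def fun_eq_iff cong: if_cong)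
       (simp add: step_block_def[abs_def] restrict_def cong: if_cong)
  note indep = this
  have vimage: "step_block s k -` {x\<in>{1..k} \<rightarrow>\<^sub>E carrier G. Q x} \<inter> space M =
      {\<omega>\<in>space M. Q (step_block s k \<omega>)}" for s k Q
    by (auto simp: step_block_def step_in_carrier)
  from indep_varD[OF indep, of "{x\<in>{1..k} \<rightarrow>\<^sub>E carrier G. Q x}" "{x\<in>{1..l} \<rightarrow>\<^sub>E carrier G. R x}"]
  have "prob ((\<lambda>x. (step_block s k x, step_block t l x)) -`
        ({x\<in>{1..k} \<rightarrow>\<^sub>E carrier G. Q x} \<times> {x\<in>{1..l} \<rightarrow>\<^sub>E carrier G. R x}) \<inter> space M) =
      prob (step_block s k -` {x\<in>{1..k} \<rightarrow>\<^sub>E carrier G. Q x} \<inter> space M) *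
      prob (step_block t l -` {x\<in>{1..l} \<rightarrow>\<^sub>E carrier G. R x} \<inter> space M)"
    by (simp add: PiM_carrier_eq_count_space Collect_mono_iff)
  also have "(\<lambda>x. (step_block s k x, step_block t l x)) -`
        ({x\<in>{1..k} \<rightarrow>\<^sub>E carrier G. Q x} \<times> {x\<in>{1..l} \<rightarrow>\<^sub>E carrier G. R x}) \<inter> space M =
      {\<omega>\<in>space M. Q (step_block s k \<omega>) \<and> R (step_block t l \<omega>)}"
    by (auto simp: step_block_def step_in_carrier)
  finally show ?thesis by (simp only: vimage)
qed

section \<open>The number of returns is asymptotically geometric\<close>

definition returns :: "nat \<Rightarrow> nat \<Rightarrow> 'w \<Rightarrow> nat" where
  "returns s m \<omega> = return_count G (\<lambda>i. \<xi> (s + i) \<omega>) m"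

definition returns_tail :: "nat \<Rightarrow> nat \<Rightarrow> real" where
  "returns_tail m a = prob {\<omega>\<in>space M. a \<le> returns 0 m \<omega>}"

lemma returns_step_block: "returns s m \<omega> = return_count G (step_block s m \<omega>) m"
  unfolding returns_def by (rule return_count_cong) (auto simp: step_block_def)

lemma first_return_step_block:
  "first_return_at G (\<lambda>i. \<xi> (s + i) \<omega>) k \<longleftrightarrow> first_return_at G (step_block s k \<omega>) k"
  by (rule first_return_at_cong) (auto simp: step_block_def)

lemma returns_event [measurable]: "{\<omega>\<in>space M. a \<le> returns s m \<omega>} \<in> events"
  unfolding returns_step_block by (rule block_event_measurable)

lemma returns_measurable [measurable]: "returns s m \<in> measurable M (count_space UNIV)"
proof (rule measurable_count_space_eq2_countable[THEN iffD2])
qed (auto intro: block_event_measurable simp: returns_step_block vimage_def Int_def conj_commute)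

lemma prob_returns: "prob {\<omega>\<in>space M. a \<le> returns s m \<omega>} = returns_tail m a"
  unfolding returns_tail_def returns_step_block by (rule prob_block_shift)

lemma returns_tail_0: "returns_tail m 0 = 1"
  by (simp add: returns_tail_def prob_space)

lemma returns_tail_mono: "m \<le> n \<Longrightarrow> returns_tail m a \<le> returns_tail n a"
  unfolding returns_tail_def
  by (intro finite_measure_mono returns_event) (auto simp: returns_def intro: order.trans return_count_mono)

definition first_return_prob :: "nat \<Rightarrow> real" where
  "first_return_prob k = prob {\<omega>\<in>space M. first_return_at G (\<lambda>i. \<xi> i \<omega>) k}"

lemma first_return_event: "{\<omega>\<in>space M. first_return_at G (\<lambda>i. \<xi> (s + i) \<omega>) k} \<in> events"
  unfolding first_return_step_block by (rule block_event_measurable)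

text \<open>Renewal equation: the first return at time \<open>k\<close> is decided by the first \<open>k\<close> steps, and the
  further returns by the steps after them.\<close>

lemma returns_tail_Suc:
  "returns_tail m (Suc a) = (\<Sum>k=1..m. first_return_prob k * returns_tail (m - k) a)"
proof -
  let ?E = "\<lambda>k. {\<omega>\<in>space M. first_return_at G (\<lambda>i. \<xi> i \<omega>) k \<and> a \<le> returns k (m - k) \<omega>}"
  have split: "Suc a \<le> returns 0 m \<omega> \<longleftrightarrow>
      (\<exists>k\<in>{1..m}. first_return_at G (\<lambda>i. \<xi> i \<omega>) k \<and> a \<le> returns k (m - k) \<omega>)"
    if "\<omega> \<in> space M" for \<omega>
  proof -
    have step: "returns 0 m \<omega> = Suc (returns k (m - k) \<omega>)"
      if "k \<in> {1..m}" "first_return_at G (\<lambda>i. \<xi> i \<omega>) k" for k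
      using return_count_after_first_return[of "\<lambda>i. \<xi> i \<omega>" k m] that \<open>\<omega> \<in> space M\<close>
      by (auto simp: returns_def step_in_carrier)
    have "\<exists>k\<in>{1..m}. first_return_at G (\<lambda>i. \<xi> i \<omega>) k" if "Suc a \<le> returns 0 m \<omega>"
      using that return_count_pos_iff_first_return[of G "\<lambda>i. \<xi> i \<omega>" m]
      by (auto simp: returns_def)
    with step show ?thesis by (metis Suc_le_mono)
  qed
  have ev: "?E k \<in> events" for k
  proof -
    have "?E k = {\<omega>\<in>space M. first_return_at G (\<lambda>i. \<xi> (0 + i) \<omega>) k} \<inter>
        {\<omega>\<in>space M. a \<le> returns k (m - k) \<omega>}" by auto
    also have "\<dots> \<in> events" by (intro sets.Int first_return_event returns_event)
    finally show ?thesis .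
  qed
  have "returns_tail m (Suc a) = prob (\<Union>k\<in>{1..m}. ?E k)"
    unfolding returns_tail_def by (intro arg_cong[where f = prob]) (use split in blast)
  also have "\<dots> = (\<Sum>k=1..m. prob (?E k))"
  proof (rule finite_measure_finite_Union)
    show "disjoint_family_on ?E {1..m}"
      using first_return_at_unique by (fastforce simp: disjoint_family_on_def)
  qed (use ev in auto)
  also have "\<dots> = (\<Sum>k=1..m. first_return_prob k * returns_tail (m - k) a)"
  proof (intro sum.cong refl)
    fix k
    have "prob (?E k) = prob {\<omega>\<in>space M. first_return_at G (\<lambda>i. \<xi> (0 + i) \<omega>) k} *
        prob {\<omega>\<in>space M. a \<le> returns k (m - k) \<omega>}"
      using prob_disjoint_blocks[of 0 k k "\<lambda>x. first_return_at G x k"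
          "\<lambda>x. a \<le> return_count G x (m - k)" "m - k"]
      by (simp add: first_return_step_block[symmetric] returns_step_block[symmetric]
            first_return_step_block[of 0, simplified, symmetric])
    then show "prob (?E k) = first_return_prob k * returns_tail (m - k) a"
      by (simp add: first_return_prob_def prob_returns)
  qed
  finally show ?thesis .
qed

lemma returns_tail_1: "returns_tail m 1 = (\<Sum>k=1..m. first_return_prob k)"
  using returns_tail_Suc[of m 0] by (simp add: returns_tail_0)

lemma first_return_prob_nonneg: "0 \<le> first_return_prob k"
  by (simp add: first_return_prob_def)

lemma returns_tail_nonneg: "0 \<le> returns_tail m a"
  by (simp add: returns_tail_def)

text \<open>The walk may differ from the ordered product only at time \<open>0\<close>, on a null set.\<close>

lemma AE_walk_eq_ordered_product:
  "AE \<omega> in M. \<omega> \<in> space M \<and> (\<forall>n. S n \<omega> = ordered_product G \<xi> n \<omega>)"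
proof -
  have "S n \<omega> = ordered_product G \<xi> n \<omega>" if "\<omega> \<in> space M" "S 0 \<omega> = \<one>\<^bsub>G\<^esub>" for \<omega> n
    using walk[of n \<omega>] that by (cases n) auto
  then show ?thesis by (intro AE_mp[OF start AE_I2]) blast
qed

lemma return_prob_tendsto: "(\<lambda>m. returns_tail m 1) \<longlonglongrightarrow> 1 - escape_prob M G S"
proof -
  let ?E = "\<lambda>m. {\<omega>\<in>space M. 1 \<le> returns 0 m \<omega>}"
  have "(\<lambda>m. prob (?E m)) \<longlonglongrightarrow> prob (\<Union>m. ?E m)"
  proof (rule finite_Lim_measure_incseq)
    show "incseq ?E"
      by (auto simp: incseq_def returns_def intro: order.trans return_count_mono)
  qed auto
  also have E_eq: "(\<Union>m. ?E m) = space M - {\<omega>\<in>space M. \<forall>n\<ge>1. S n \<omega> \<noteq> \<one>\<^bsub>G\<^esub>}"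
  proof -
    have "1 \<le> returns 0 m \<omega> \<longleftrightarrow> (\<exists>k\<in>{1..m}. S k \<omega> = \<one>\<^bsub>G\<^esub>)" if "\<omega> \<in> space M" for m \<omega>
    proof -
      have S_eq: "S k \<omega> = partial_product G (\<lambda>i. \<xi> i \<omega>) k" if "1 \<le> k" for k
        using walk[OF that \<open>\<omega> \<in> space M\<close>] ordered_product_eq_partial_product[of G \<xi> k \<omega>] by simp
      have "1 \<le> returns 0 m \<omega> \<longleftrightarrow> {k\<in>{1..m}. partial_product G (\<lambda>i. \<xi> i \<omega>) k = \<one>\<^bsub>G\<^esub>} \<noteq> {}"
        by (simp add: returns_def return_count_def Suc_le_eq card_gt_0_iff)
      also have "\<dots> \<longleftrightarrow> (\<exists>k\<in>{1..m}. S k \<omega> = \<one>\<^bsub>G\<^esub>)"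
        using S_eq by auto
      finally show ?thesis .
    qed
    then have "(\<exists>m. 1 \<le> returns 0 m \<omega>) \<longleftrightarrow> (\<exists>k\<ge>1. S k \<omega> = \<one>\<^bsub>G\<^esub>)" if "\<omega> \<in> space M" for \<omega>
      using that by (metis atLeastAtMost_iff order_refl)
    then show ?thesis by blast
  qed
  also have "prob \<dots> = 1 - escape_prob M G S"
  proof -
    have "(\<Union>m. ?E m) \<in> events" by (intro sets.countable_UN) (auto intro: returns_event)
    then have "space M - (\<Union>m. ?E m) \<in> events" by (rule sets.compl_sets)
    also have "space M - (\<Union>m. ?E m) = {\<omega>\<in>space M. \<forall>n\<ge>1. S n \<omega> \<noteq> \<one>\<^bsub>G\<^esub>}"
      unfolding E_eq by (rule double_diff) blast+
    finally have "{\<omega>\<in>space M. \<forall>n\<ge>1. S n \<omega> \<noteq> \<one>\<^bsub>G\<^esub>} \<in> events" .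
    then show ?thesis by (simp only: prob_compl escape_prob_def)
  qed
  finally show ?thesis by (simp only: returns_tail_def)
qed

lemma return_prob_le: "returns_tail m 1 \<le> 1 - escape_prob M G S"
  using returns_tail_mono by (intro incseq_le return_prob_tendsto) (auto simp: incseq_def)

lemma returns_tail_le: "returns_tail m a \<le> (1 - escape_prob M G S) ^ a"
proof (induction a arbitrary: m)
  case 0
  then show ?case by (simp add: returns_tail_0)
next
  case (Suc a)
  have "returns_tail m (Suc a) \<le> (\<Sum>k=1..m. first_return_prob k * (1 - escape_prob M G S) ^ a)"
    unfolding returns_tail_Suc
    by (intro sum_mono mult_left_mono Suc.IH first_return_prob_nonneg)
  also have "\<dots> = returns_tail m 1 * (1 - escape_prob M G S) ^ a"
    by (simp only: returns_tail_1 sum_distrib_right)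
  also have "\<dots> \<le> (1 - escape_prob M G S) * (1 - escape_prob M G S) ^ a"
    by (intro mult_right_mono return_prob_le) (simp add: escape_prob_def)
  finally show ?case by simp
qed

text \<open>A horizon of length \<open>a * m\<close> leaves room for \<open>a\<close> successive returns, each taking at most \<open>m\<close> steps.\<close>

lemma returns_tail_ge: "(returns_tail m 1) ^ a \<le> returns_tail (a * m) a"
proof (induction a)
  case 0
  then show ?case by (simp add: returns_tail_0)
next
  case (Suc a)
  have "(returns_tail m 1) ^ Suc a \<le> returns_tail m 1 * returns_tail (a * m) a"
    using Suc by (simp add: mult_left_mono returns_tail_nonneg)
  also have "\<dots> = (\<Sum>k=1..m. first_return_prob k * returns_tail (a * m) a)"
    by (simp only: returns_tail_1 sum_distrib_right)
  also have "\<dots> \<le> (\<Sum>k=1..m. first_return_prob k * returns_tail (Suc a * m - k) a)"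
    by (intro sum_mono mult_left_mono returns_tail_mono first_return_prob_nonneg) auto
  also have "\<dots> \<le> (\<Sum>k=1..Suc a * m. first_return_prob k * returns_tail (Suc a * m - k) a)"
    by (intro sum_mono2) (auto simp: first_return_prob_nonneg returns_tail_nonneg)
  also have "\<dots> = returns_tail (Suc a * m) (Suc a)" by (simp only: returns_tail_Suc)
  finally show ?case .
qed

lemma returns_tail_tendsto: "(\<lambda>m. returns_tail m a) \<longlonglongrightarrow> (1 - escape_prob M G S) ^ a"
proof -
  have inc: "incseq (\<lambda>m. returns_tail m a)" by (auto simp: incseq_def returns_tail_mono)
  obtain L where L: "(\<lambda>m. returns_tail m a) \<longlonglongrightarrow> L"
  proof (rule incseq_convergent[OF inc])
    show "\<forall>i. returns_tail i a \<le> (1 - escape_prob M G S) ^ a" using returns_tail_le by simp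
  qed
  have "(1 - escape_prob M G S) ^ a \<le> L"
  proof (rule LIMSEQ_le_const2[OF tendsto_power[OF return_prob_tendsto]])
    have "returns_tail n 1 ^ a \<le> L" for n
      by (rule order.trans[OF returns_tail_ge incseq_le[OF inc L]])
    then show "\<exists>N. \<forall>n\<ge>N. returns_tail n 1 ^ a \<le> L" by simp
  qed
  moreover have "L \<le> (1 - escape_prob M G S) ^ a"
    by (rule LIMSEQ_le_const2[OF L]) (use returns_tail_le in auto)
  ultimately show ?thesis using L by simp
qed

end

section \<open>Null sequences in mean square\<close>

text \<open>The form in which approximation arguments are concluded below: \<open>u m\<close> is an error uniform in
  \<open>n\<close>, and \<open>v m n\<close> vanishes as \<open>n\<close> grows at fixed accuracy \<open>m\<close>.\<close>

lemma tendsto_zero_of_two_scale_bound: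
  fixes x :: "nat \<Rightarrow> real"
  assumes nonneg: "\<And>n. 0 \<le> x n" and bound: "\<And>n m. x n \<le> u m + v m n"
    and u: "u \<longlonglongrightarrow> 0" and v: "\<And>m. v m \<longlonglongrightarrow> 0"
  shows "x \<longlonglongrightarrow> 0"
proof (rule LIMSEQ_I)
  fix e :: real assume e: "0 < e"
  then obtain m where "\<bar>u m\<bar> < e / 2"
    using LIMSEQ_D[OF u, of "e / 2"] by auto
  moreover obtain N where "\<And>n. n \<ge> N \<Longrightarrow> \<bar>v m n\<bar> < e / 2"
    using LIMSEQ_D[OF v[of m], of "e / 2"] e by auto
  ultimately have "\<bar>x n\<bar> < e" if "n \<ge> N" for n
    using nonneg[of n] bound[of n m] that by (smt (verit) field_sum_of_halves)
  then show "\<exists>N. \<forall>n\<ge>N. norm (x n - 0) < e" by auto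
qed

lemma square_add_le: "(a + b)\<^sup>2 \<le> 2 * a\<^sup>2 + 2 * b\<^sup>2" for a b :: real
  using sum_squares_bound[of a b] by (simp add: power2_sum)

lemma square_integrable_add:
  assumes "square_integrable M X" "square_integrable M Y"
  shows "square_integrable M (\<lambda>\<omega>. X \<omega> + Y \<omega>)"
proof -
  have [measurable]: "X \<in> borel_measurable M" "Y \<in> borel_measurable M"
    using assms by (auto simp: square_integrable_def)
  have "integrable M (\<lambda>\<omega>. (X \<omega> + Y \<omega>)\<^sup>2)"
  proof (rule Bochner_Integration.integrable_bound)
    show "integrable M (\<lambda>\<omega>. 2 * (X \<omega>)\<^sup>2 + 2 * (Y \<omega>)\<^sup>2)"
      using assms by (auto simp: square_integrable_def)
    show "AE \<omega> in M. norm ((X \<omega> + Y \<omega>)\<^sup>2) \<le> norm (2 * (X \<omega>)\<^sup>2 + 2 * (Y \<omega>)\<^sup>2)"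
      using square_add_le by auto
  qed simp
  then show ?thesis by (simp add: square_integrable_def)
qed

lemma square_integrable_cmult:
  "square_integrable M X \<Longrightarrow> square_integrable M (\<lambda>\<omega>. c * X \<omega>)"
  by (auto simp: square_integrable_def power_mult_distrib)

lemma (in prob_space) square_integrable_const: "square_integrable M (\<lambda>_. c)"
  by (simp add: square_integrable_def)

lemma tendsto_L2_zero_add:
  assumes "tendsto_L2 M X (\<lambda>_. 0)" "tendsto_L2 M Y (\<lambda>_. 0)"
  shows "tendsto_L2 M (\<lambda>n \<omega>. X n \<omega> + Y n \<omega>) (\<lambda>_. 0)"
proof -
  have sq: "square_integrable M (X n)" "square_integrable M (Y n)" for n
    using assms by (auto simp: tendsto_L2_def)
  have lim: "(\<lambda>n. \<integral>\<omega>. (X n \<omega>)\<^sup>2 \<partial>M) \<longlonglongrightarrow> 0" "(\<lambda>n. \<integral>\<omega>. (Y n \<omega>)\<^sup>2 \<partial>M) \<longlonglongrightarrow> 0"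
    using assms by (auto simp: tendsto_L2_def)
  have "(\<integral>\<omega>. (X n \<omega> + Y n \<omega>)\<^sup>2 \<partial>M) \<le> 2 * (\<integral>\<omega>. (X n \<omega>)\<^sup>2 \<partial>M) + 2 * (\<integral>\<omega>. (Y n \<omega>)\<^sup>2 \<partial>M)" for n
  proof -
    have "(\<integral>\<omega>. (X n \<omega> + Y n \<omega>)\<^sup>2 \<partial>M) \<le> (\<integral>\<omega>. 2 * (X n \<omega>)\<^sup>2 + 2 * (Y n \<omega>)\<^sup>2 \<partial>M)"
    proof (rule integral_mono)
      show "integrable M (\<lambda>\<omega>. (X n \<omega> + Y n \<omega>)\<^sup>2)"
        using square_integrable_add[OF sq] by (simp add: square_integrable_def)
      show "integrable M (\<lambda>\<omega>. 2 * (X n \<omega>)\<^sup>2 + 2 * (Y n \<omega>)\<^sup>2)"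
        using sq[of n] by (simp add: square_integrable_def)
    qed (rule square_add_le)
    then show ?thesis using sq[of n] by (simp add: square_integrable_def)
  qed
  note bound = this
  have "(\<lambda>n. 2 * (\<integral>\<omega>. (X n \<omega>)\<^sup>2 \<partial>M) + 2 * (\<integral>\<omega>. (Y n \<omega>)\<^sup>2 \<partial>M)) \<longlonglongrightarrow> 0"
    using tendsto_add[OF tendsto_mult_left[OF lim(1), of 2] tendsto_mult_left[OF lim(2), of 2]] by simp
  then have "(\<lambda>n. \<integral>\<omega>. (X n \<omega> + Y n \<omega>)\<^sup>2 \<partial>M) \<longlonglongrightarrow> 0"
  proof (rule tendsto_sandwich[OF always_eventually always_eventually tendsto_const, rotated 2])
    show "\<forall>n. 0 \<le> (\<integral>\<omega>. (X n \<omega> + Y n \<omega>)\<^sup>2 \<partial>M)" by simp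
  qed (use bound in blast)
  then show ?thesis
    using square_integrable_add[OF sq] assms by (simp add: tendsto_L2_def)
qed

lemma tendsto_L2_zero_cmult:
  assumes "tendsto_L2 M X (\<lambda>_. 0)"
  shows "tendsto_L2 M (\<lambda>n \<omega>. c * X n \<omega>) (\<lambda>_. 0)"
proof -
  have "(\<lambda>n. c\<^sup>2 * (\<integral>\<omega>. (X n \<omega>)\<^sup>2 \<partial>M)) \<longlonglongrightarrow> c\<^sup>2 * 0"
    using assms by (intro tendsto_mult_left) (simp add: tendsto_L2_def)
  then show ?thesis
    using assms square_integrable_cmult[where M = M]
    by (simp add: tendsto_L2_def power_mult_distrib square_integrable_cmult)
qed

lemma tendsto_L2_zero_sum:
  assumes "finite J" "\<And>j. j \<in> J \<Longrightarrow> tendsto_L2 M (X j) (\<lambda>_. 0)"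
  shows "tendsto_L2 M (\<lambda>n \<omega>. \<Sum>j\<in>J. X j n \<omega>) (\<lambda>_. 0)"
  using assms
proof (induction J rule: finite_induct)
  case empty
  show ?case by (simp add: tendsto_L2_def square_integrable_def)
next
  case (insert j J)
  then show ?case using tendsto_L2_zero_add[of M "X j" "\<lambda>n \<omega>. \<Sum>j\<in>J. X j n \<omega>"] by simp
qed

section \<open>A law of large numbers for the frequency of return counts\<close>

context random_walk
begin

text \<open>The probability that the walk ever returns to its starting point.\<close>

abbreviation "q \<equiv> 1 - escape_prob M G S"

lemma q_bounds: "0 \<le> q" "q \<le> 1"
  by (simp_all add: escape_prob_def)

text \<open>Almost independence of times at distance at least \<open>m\<close>. Cutting the horizon of the earlier time
  down to \<open>m\<close> makes the two events independent, and the cut loses probability at most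
  \<open>q ^ a - returns_tail m a\<close>, because the tail over every horizon is at most \<open>q ^ a\<close>.\<close>

lemma prob_two_returns_le:
  assumes "i + m \<le> j" "m \<le> M'"
  shows "prob {\<omega>\<in>space M. a \<le> returns i M' \<omega> \<and> a \<le> returns j l \<omega>} \<le>
    (q ^ a)\<^sup>2 + (q ^ a - returns_tail m a)"
proof -
  let ?A = "\<lambda>m. {\<omega>\<in>space M. a \<le> returns i m \<omega>}" and ?B = "{\<omega>\<in>space M. a \<le> returns j l \<omega>}"
  have sub: "?A m \<subseteq> ?A M'"
    using return_count_mono[OF assms(2)] by (auto simp: returns_def intro: order.trans)
  have "prob {\<omega>\<in>space M. a \<le> returns i M' \<omega> \<and> a \<le> returns j l \<omega>} \<le> prob ((?A m \<inter> ?B) \<union> (?A M' - ?A m))"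
    by (intro finite_measure_mono) auto
  also have "\<dots> \<le> prob (?A m \<inter> ?B) + prob (?A M' - ?A m)"
    by (intro measure_Un_le) auto
  also have "?A m \<inter> ?B = {\<omega>\<in>space M. a \<le> returns i m \<omega> \<and> a \<le> returns j l \<omega>}" by auto
  also have "prob \<dots> = returns_tail m a * returns_tail l a"
    using prob_disjoint_blocks[OF assms(1), of "\<lambda>x. a \<le> return_count G x m"
        "\<lambda>x. a \<le> return_count G x l" l]
    by (simp add: returns_step_block[symmetric] prob_returns)
  also have "\<dots> \<le> (q ^ a)\<^sup>2"
    unfolding power2_eq_square
    by (intro mult_mono returns_tail_le returns_tail_nonneg zero_le_power q_bounds)
  also have "prob (?A M' - ?A m) = returns_tail M' a - returns_tail m a"
    using finite_measure_Diff[OF returns_event returns_event sub] by (simp add: prob_returns)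
  also have "\<dots> \<le> q ^ a - returns_tail m a" by (simp add: returns_tail_le)
  finally show ?thesis by simp
qed

definition return_level :: "nat \<Rightarrow> nat \<Rightarrow> 'w \<Rightarrow> real" where
  "return_level a n \<omega> = (\<Sum>i<n. of_bool (a \<le> returns i (n - 1 - i) \<omega>))"

lemma of_bool_returns_measurable [measurable]:
  "(\<lambda>\<omega>. of_bool (a \<le> returns i m \<omega>) :: real) \<in> borel_measurable M"
  by (rule measurable_compose[OF returns_measurable]) simp

lemma return_level_measurable [measurable]: "return_level a n \<in> borel_measurable M"
  unfolding return_level_def[abs_def] by measurable

lemma return_level_bounds: "0 \<le> return_level a n \<omega>" "return_level a n \<omega> \<le> n"
proof -
  have "return_level a n \<omega> \<le> (\<Sum>i<n. 1)"
    unfolding return_level_def by (intro sum_mono) auto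
  then show "return_level a n \<omega> \<le> n" by simp
qed (auto simp: return_level_def intro!: sum_nonneg)

lemma expectation_of_bool:
  "{\<omega>\<in>space M. P \<omega>} \<in> events \<Longrightarrow> expectation (\<lambda>\<omega>. of_bool (P \<omega>)) = prob {\<omega>\<in>space M. P \<omega>}"
  "{\<omega>\<in>space M. P \<omega>} \<in> events \<Longrightarrow> integrable M (\<lambda>\<omega>. of_bool (P \<omega>) :: real)"
proof -
  assume P: "{\<omega>\<in>space M. P \<omega>} \<in> events"
  have ind: "of_bool (P \<omega>) = indicat_real {\<omega>\<in>space M. P \<omega>} \<omega>" if "\<omega> \<in> space M" for \<omega>
    using that by (simp add: indicator_def)
  show "expectation (\<lambda>\<omega>. of_bool (P \<omega>)) = prob {\<omega>\<in>space M. P \<omega>}"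
    using P by (subst Bochner_Integration.integral_cong[OF refl ind]) (auto simp: Int_def intro!: arg_cong[where f = prob])
  show "integrable M (\<lambda>\<omega>. of_bool (P \<omega>) :: real)"
    using P by (subst Bochner_Integration.integrable_cong[OF refl ind]) (auto simp: emeasure_eq_measure)
qed

text \<open>For pairs of times within distance \<open>m\<close> the probability is bounded trivially by one; each time has at most \<open>2 * m + 1\<close>
  such partners.\<close>

lemma return_level_second_moment_le:
  "expectation (\<lambda>\<omega>. (return_level a n \<omega>)\<^sup>2) \<le>
    real n * real n * ((q ^ a)\<^sup>2 + (q ^ a - returns_tail m a)) + real n * (2 * real m + 1)"
proof -
  define r where "r = (\<lambda>i. n - 1 - i)"
  let ?e = "\<lambda>i \<omega>. a \<le> returns i (r i) \<omega>"
  let ?P = "\<lambda>i j. prob {\<omega>\<in>space M. ?e i \<omega> \<and> ?e j \<omega>}"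
  let ?b = "(q ^ a)\<^sup>2 + (q ^ a - returns_tail m a)"
  have b0: "0 \<le> ?b" using returns_tail_le by simp
  have ev: "{\<omega>\<in>space M. ?e i \<omega> \<and> ?e j \<omega>} \<in> events" for i j by measurable
  have pair: "?P i j \<le> ?b + of_bool (i \<le> j + m \<and> j \<le> i + m)" if "i < n" "j < n" for i j
  proof (cases "i \<le> j + m \<and> j \<le> i + m")
    case True
    then show ?thesis using b0 by (simp add: add_increasing)
  next
    case False
    then consider "i + m < j" | "j + m < i" by linarith
    then show ?thesis
    proof cases
      case 1
      with prob_two_returns_le[of i m j "r i" a "r j"] that show ?thesis by (auto simp: r_def)
    next
      case 2
      with prob_two_returns_le[of j m i "r j" a "r i"] that show ?thesis
        by (auto simp: r_def conj_commute)
    qed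
  qed
  have near: "(\<Sum>j<n. of_bool (i \<le> j + m \<and> j \<le> i + m)) \<le> 2 * real m + 1" for i
  proof -
    have "card {j\<in>{..<n}. i \<le> j + m \<and> j \<le> i + m} \<le> card {i - m..i + m}"
      by (intro card_mono) auto
    also have "\<dots> \<le> 2 * m + 1" by simp
    finally have "real (card {j\<in>{..<n}. i \<le> j + m \<and> j \<le> i + m}) \<le> real (2 * m + 1)"
      by (simp only: of_nat_le_iff)
    then show ?thesis by (simp add: sum_of_bool_eq Int_def conj_commute)
  qed
  \<comment> \<open>The square of the count is the number of ordered pairs of counted times.\<close>
  have "(return_level a n \<omega>)\<^sup>2 = (\<Sum>i<n. \<Sum>j<n. of_bool (?e i \<omega> \<and> ?e j \<omega>))" for \<omega>
    by (simp add: return_level_def r_def power2_eq_square sum_product of_bool_conj del: sum_of_bool_eq)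
  then have "expectation (\<lambda>\<omega>. (return_level a n \<omega>)\<^sup>2) = (\<Sum>i<n. \<Sum>j<n. ?P i j)"
    by (simp add: expectation_of_bool[OF ev] Bochner_Integration.integral_sum Bochner_Integration.integrable_sum del: of_bool_conj sum_of_bool_eq)
  also have "\<dots> \<le> (\<Sum>i<n. \<Sum>j<n. ?b + of_bool (i \<le> j + m \<and> j \<le> i + m))"
    by (intro sum_mono pair) auto
  also have "\<dots> = (\<Sum>i<n. real n * ?b + (\<Sum>j<n. of_bool (i \<le> j + m \<and> j \<le> i + m)))"
    by (simp add: sum.distrib)
  also have "\<dots> \<le> (\<Sum>i<n. real n * ?b + (2 * real m + 1))"
    by (intro sum_mono add_left_mono near)
  also have "\<dots> = real n * real n * ?b + real n * (2 * real m + 1)"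
    by (simp add: algebra_simps)
  finally show ?thesis .
qed

text \<open>Only the last \<open>m\<close> times have a horizon shorter than \<open>m\<close>.\<close>

lemma return_level_mean_ge:
  "real n * returns_tail m a - real m \<le> expectation (return_level a n)"
proof -
  have "card {i\<in>{..<n}. n - 1 - i < m} \<le> card {n - m..<n}"
    by (intro card_mono) auto
  also have "\<dots> \<le> m" by simp
  finally have late: "(\<Sum>i<n. of_bool (n - 1 - i < m)) \<le> real m"
    by (simp add: sum_of_bool_eq Int_def conj_commute)
  have "real n * returns_tail m a - real m \<le> (\<Sum>i<n. returns_tail m a - of_bool (n - 1 - i < m))"
    using late by (simp add: sum_subtractf)
  also have "\<dots> \<le> (\<Sum>i<n. returns_tail (n - 1 - i) a)"
  proof (intro sum_mono)
    fix i
    have "returns_tail m a \<le> 1" by (simp add: returns_tail_def)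
    then show "returns_tail m a - of_bool (n - 1 - i < m) \<le> returns_tail (n - 1 - i) a"
      using returns_tail_mono[of m "n - 1 - i" a] returns_tail_nonneg[of "n - 1 - i" a]
      by (cases "n - 1 - i < m") auto
  qed
  also have "\<dots> = expectation (return_level a n)"
    unfolding return_level_def[abs_def]
    by (simp add: expectation_of_bool[OF returns_event] prob_returns del: sum_of_bool_eq)
  finally show ?thesis .
qed

text \<open>Expanding the square needs the second moment from above and the mean only from below, so the
  two preceding bounds suffice.\<close>

lemma return_level_variance_le:
  assumes "0 < n"
  shows "expectation (\<lambda>\<omega>. (return_level a n \<omega> / real n - q ^ a)\<^sup>2) \<le>
    3 * (q ^ a - returns_tail m a) + (4 * real m + 1) / real n"
proof -
  let ?Z = "return_level a n" and ?c = "q ^ a" and ?t = "returns_tail m a"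
  have Z: "integrable M ?Z" "integrable M (\<lambda>\<omega>. (?Z \<omega>)\<^sup>2)"
  proof -
    show "integrable M ?Z"
      by (rule integrable_const_bound[of _ "real n"]) (use return_level_bounds in auto)
    show "integrable M (\<lambda>\<omega>. (?Z \<omega>)\<^sup>2)"
      by (rule integrable_const_bound[of _ "(real n)\<^sup>2"])
         (use return_level_bounds in \<open>auto intro!: power_mono\<close>)
  qed
  have c: "0 \<le> ?c" "?c \<le> 1" "?t \<le> ?c"
    using q_bounds returns_tail_le by (auto intro: power_le_one)
  have "(\<lambda>\<omega>. (?Z \<omega> / real n - ?c)\<^sup>2) =
      (\<lambda>\<omega>. (?Z \<omega>)\<^sup>2 / (real n)\<^sup>2 - (2 * ?c / real n) * ?Z \<omega> + ?c\<^sup>2)"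
    using assms by (auto simp: fun_eq_iff power2_eq_square field_simps)
  then have "expectation (\<lambda>\<omega>. (?Z \<omega> / real n - ?c)\<^sup>2) =
      expectation (\<lambda>\<omega>. (?Z \<omega>)\<^sup>2) / (real n)\<^sup>2 - (2 * ?c / real n) * expectation ?Z + ?c\<^sup>2"
    using Z by (simp add: prob_space)
  also have "\<dots> \<le> (real n * real n * (?c\<^sup>2 + (?c - ?t)) + real n * (2 * real m + 1)) / (real n)\<^sup>2
      - (2 * ?c / real n) * (real n * ?t - real m) + ?c\<^sup>2"
    using c by (intro add_mono diff_mono divide_right_mono mult_left_mono order.refl
        return_level_second_moment_le return_level_mean_ge) auto
  also have "\<dots> = (1 + 2 * ?c) * (?c - ?t) + (2 * real m + 1 + 2 * ?c * real m) / real n"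
    using assms by (simp add: field_simps power2_eq_square)
  also have "\<dots> \<le> 3 * (?c - ?t) + (4 * real m + 1) / real n"
  proof (rule add_mono)
    show "(1 + 2 * ?c) * (?c - ?t) \<le> 3 * (?c - ?t)"
      by (rule mult_right_mono) (use c in auto)
    show "(2 * real m + 1 + 2 * ?c * real m) / real n \<le> (4 * real m + 1) / real n"
      by (rule divide_right_mono) (use mult_right_mono[OF c(2), of "2 * real m"] in auto)
  qed
  finally show ?thesis .
qed

lemma return_level_tendsto_L2:
  "tendsto_L2 M (\<lambda>n \<omega>. return_level a (Suc n) \<omega> / real (Suc n) - q ^ a) (\<lambda>_. 0)"
proof -
  have "(\<lambda>n. expectation (\<lambda>\<omega>. (return_level a (Suc n) \<omega> / real (Suc n) - q ^ a)\<^sup>2)) \<longlonglongrightarrow> 0"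
  proof (rule tendsto_zero_of_two_scale_bound)
    show "(\<lambda>m. 3 * (q ^ a - returns_tail m a)) \<longlonglongrightarrow> 0"
      using tendsto_mult_left[OF tendsto_diff[OF tendsto_const returns_tail_tendsto], of 3 "q ^ a" a]
      by simp
    show "(\<lambda>n. (4 * real m + 1) / real (Suc n)) \<longlonglongrightarrow> 0" for m
      using LIMSEQ_Suc[OF lim_const_over_n] by auto
    show "expectation (\<lambda>\<omega>. (return_level a (Suc n) \<omega> / real (Suc n) - q ^ a)\<^sup>2) \<le>
        3 * (q ^ a - returns_tail m a) + (4 * real m + 1) / real (Suc n)" for n m
      by (rule return_level_variance_le) simp
  qed simp
  moreover have "square_integrable M (\<lambda>\<omega>. return_level a (Suc n) \<omega> / real (Suc n) - q ^ a)" for n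
  proof -
    have "norm ((return_level a (Suc n) \<omega> / real (Suc n) - q ^ a)\<^sup>2) \<le> 1" for \<omega>
    proof -
      have "0 \<le> return_level a (Suc n) \<omega> / real (Suc n)" "return_level a (Suc n) \<omega> / real (Suc n) \<le> 1"
        using return_level_bounds[of a "Suc n" \<omega>] by (auto simp: divide_simps)
      moreover have "0 \<le> q ^ a" "q ^ a \<le> 1" using q_bounds by (auto intro: power_le_one)
      ultimately have "\<bar>return_level a (Suc n) \<omega> / real (Suc n) - q ^ a\<bar> \<le> 1" by linarith
      then show ?thesis by (simp add: abs_square_le_1)
    qed
    then show ?thesis
      unfolding square_integrable_def by (auto intro!: integrable_const_bound[of _ 1])
  qed
  ultimately show ?thesis
    by (simp add: tendsto_L2_def square_integrable_const)
qed

end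

section \<open>Local time functionals of the walk\<close>

lemma local_time_functional_eq_sum_over_times:
  fixes f :: "nat \<Rightarrow> real"
  assumes S: "\<And>i. i \<le> n \<Longrightarrow> S i \<omega> \<in> carrier G" and f0: "f 0 = 0"
  shows "local_time_functional G S f (Suc n) \<omega> =
    (\<Sum>i<Suc n. f (Suc (later_visits (\<lambda>k. S k \<omega>) (Suc n) i)) - f (later_visits (\<lambda>k. S k \<omega>) (Suc n) i))"
proof -
  let ?X = "(\<lambda>k. S k \<omega>) ` {..<Suc n}"
  have lt: "local_time S n x \<omega> = card {k. k < Suc n \<and> S k \<omega> = x}" for x
  proof -
    have "{..n} \<inter> {k. S k \<omega> = x} = {k. k < Suc n \<and> S k \<omega> = x}" by auto
    then show ?thesis by (simp add: local_time_def)
  qed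
  have "local_time_functional G S f (Suc n) \<omega> = (\<Sum>\<^sub>\<infinity>x\<in>?X. f (local_time S n x \<omega>))"
    unfolding local_time_functional_def diff_Suc_1
  proof (rule infsum_cong_neutral)
    fix x assume "x \<in> carrier G - ?X"
    then have "{k. k < Suc n \<and> S k \<omega> = x} = {}" by auto
    then show "f (local_time S n x \<omega>) = 0" by (simp only: lt f0 card.empty)
  qed (use S in auto)
  also have "\<dots> = (\<Sum>x\<in>?X. f (card {k. k < Suc n \<and> S k \<omega> = x}))"
    by (simp only: infsum_finite[OF finite_imageI[OF finite_lessThan]] lt)
  also have "\<dots> = (\<Sum>i<Suc n. f (Suc (later_visits (\<lambda>k. S k \<omega>) (Suc n) i)) -
      f (later_visits (\<lambda>k. S k \<omega>) (Suc n) i))"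
    by (rule sum_over_points_eq_sum_over_times) (use f0 in auto)
  finally show ?thesis .
qed

context random_walk
begin

lemma ordered_product_measurable:
  "(\<lambda>\<omega>. ordered_product G \<xi> n \<omega>) \<in> measurable M (count_space (carrier G))"
proof -
  have closed: "ordered_product G \<xi> n \<omega> \<in> carrier G" if "\<omega> \<in> space M" for \<omega>
    by (induction n) (use that step_in_carrier in auto)
  have eq: "ordered_product G \<xi> n \<omega> = partial_product G (step_block 0 n \<omega>) n" for \<omega>
    unfolding ordered_product_eq_partial_product[of G \<xi> n \<omega>]
    by (rule partial_product_cong) (simp add: step_block_def)
  show ?thesis
  proof (rule measurable_count_space_eq_countable[OF countable_carrier, THEN iffD2], intro conjI ballI)
    show "(\<lambda>\<omega>. ordered_product G \<xi> n \<omega>) \<in> space M \<rightarrow> carrier G" using closed by auto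
    fix x
    have "(\<lambda>\<omega>. ordered_product G \<xi> n \<omega>) -` {x} \<inter> space M =
        {\<omega>\<in>space M. partial_product G (step_block 0 n \<omega>) n = x}"
      using eq by auto
    then show "(\<lambda>\<omega>. ordered_product G \<xi> n \<omega>) -` {x} \<inter> space M \<in> events"
      using block_event_measurable[of "\<lambda>y. partial_product G y n = x" 0 n] by simp
  qed
qed

lemma walk_measurable: "S n \<in> measurable M (count_space (carrier G))"
proof (cases "n = 0")
  case True
  then show ?thesis using start_measurable by simp
next
  case False
  then show ?thesis
    by (subst measurable_cong[OF walk]) (auto intro: ordered_product_measurable)
qed

text \<open>Like the events above, the functional is an arbitrary function of finitely many positions in a
  countable space.\<close>

lemma local_time_functional_measurable: "local_time_functional G S f (Suc n) \<in> borel_measurable M"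
proof -
  let ?N = "PiM {..n} (\<lambda>_. count_space (carrier G))"
  let ?\<Phi> = "\<lambda>v. \<Sum>\<^sub>\<infinity>x\<in>carrier G. f (\<Sum>i\<le>n. of_bool (v i = x))"
  have "(\<lambda>\<omega>. \<lambda>i\<in>{..n}. S i \<omega>) \<in> measurable M ?N"
    by (intro measurable_restrict walk_measurable)
  moreover have "?\<Phi> \<in> borel_measurable ?N"
    by (simp add: PiM_carrier_eq_count_space)
  ultimately have "(\<lambda>\<omega>. ?\<Phi> (\<lambda>i\<in>{..n}. S i \<omega>)) \<in> borel_measurable M"
    by (rule measurable_compose)
  also have "(\<lambda>\<omega>. ?\<Phi> (\<lambda>i\<in>{..n}. S i \<omega>)) = local_time_functional G S f (Suc n)"
    by (simp add: local_time_functional_def[abs_def] local_time_def)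
  finally show ?thesis .
qed

text \<open>By left cancellation the walk is again at its time-\<open>i\<close> position exactly when the product of the steps
  since then is the identity.\<close>

lemma later_visits_eq_returns:
  assumes "\<omega> \<in> space M" "i < n"
  shows "later_visits (\<lambda>k. ordered_product G \<xi> k \<omega>) n i = returns i (n - 1 - i) \<omega>"
proof -
  let ?x = "\<lambda>i. \<xi> i \<omega>"
  let ?R = "{j\<in>{1..n - 1 - i}. partial_product G (\<lambda>j. \<xi> (i + j) \<omega>) j = \<one>\<^bsub>G\<^esub>}"
  have x: "1 \<le> k \<Longrightarrow> ?x k \<in> carrier G" for k using assms step_in_carrier by simp
  have ret: "partial_product G ?x (i + j) = partial_product G ?x i \<longleftrightarrow>
      partial_product G (\<lambda>j. \<xi> (i + j) \<omega>) j = \<one>\<^bsub>G\<^esub>" if "1 \<le> j" for j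
  proof -
    have "partial_product G ?x i \<in> carrier G" "partial_product G (\<lambda>j. \<xi> (i + j) \<omega>) j \<in> carrier G"
      using x by (auto intro!: partial_product_closed)
    then show ?thesis
      by (simp add: partial_product_add[where s = i and n = j, OF x])
  qed
  have "{k. i < k \<and> k < n \<and> partial_product G ?x k = partial_product G ?x i} = (+) i ` ?R"
  proof (intro Set.set_eqI iffI)
    fix k assume k: "k \<in> {k. i < k \<and> k < n \<and> partial_product G ?x k = partial_product G ?x i}"
    then have "k = i + (k - i)" "k - i \<in> ?R" using ret[of "k - i"] by auto
    then show "k \<in> (+) i ` ?R" by blast
  next
    fix k assume "k \<in> (+) i ` ?R"
    then show "k \<in> {k. i < k \<and> k < n \<and> partial_product G ?x k = partial_product G ?x i}"
      using ret assms(2) by auto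
  qed
  then have "later_visits (partial_product G ?x) n i = card ((+) i ` ?R)"
    by (simp add: later_visits_def)
  also have "\<dots> = card ?R" by (simp add: card_image)
  also have "\<dots> = returns i (n - 1 - i) \<omega>" by (simp add: returns_def return_count_def)
  also have "partial_product G ?x = (\<lambda>k. ordered_product G \<xi> k \<omega>)"
    using ordered_product_eq_partial_product[of G \<xi> _ \<omega>] by (intro ext) simp
  finally show ?thesis .
qed

text \<open>The local time functional in its sum-over-times form, expressed through the steps alone; it
  equals the functional of the walk almost surely.\<close>

definition walk_functional :: "(nat \<Rightarrow> real) \<Rightarrow> nat \<Rightarrow> 'w \<Rightarrow> real" where
  "walk_functional f n \<omega> =
    (\<Sum>i<n. f (Suc (returns i (n - 1 - i) \<omega>)) - f (returns i (n - 1 - i) \<omega>))"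

lemma local_time_functional_AE:
  assumes "f 0 = 0"
  shows "AE \<omega> in M. local_time_functional G S f (Suc n) \<omega> = walk_functional f (Suc n) \<omega>"
proof (rule AE_mp[OF AE_walk_eq_ordered_product AE_I2], intro impI)
  fix \<omega> assume "\<omega> \<in> space M \<and> (\<forall>n. S n \<omega> = ordered_product G \<xi> n \<omega>)"
  then have \<omega>: "\<omega> \<in> space M" and eq: "(\<lambda>k. S k \<omega>) = (\<lambda>k. ordered_product G \<xi> k \<omega>)" by auto
  have S: "S i \<omega> \<in> carrier G" for i
    using measurable_space[OF walk_measurable \<omega>] by simp
  show "local_time_functional G S f (Suc n) \<omega> = walk_functional f (Suc n) \<omega>"
    unfolding local_time_functional_eq_sum_over_times[of n S \<omega> G f, OF S assms] eq walk_functional_def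
    by (intro sum.cong refl) (simp only: later_visits_eq_returns[OF \<omega>] lessThan_iff)
qed

lemma function_of_returns_measurable [measurable]:
  "(\<lambda>\<omega>. g (returns i m \<omega>) :: real) \<in> borel_measurable M"
  by (rule measurable_compose[OF returns_measurable]) simp

lemma function_of_returns_integrable: "integrable M (\<lambda>\<omega>. g (returns i m \<omega>) :: real)"
proof (rule integrable_const_bound)
  have "\<bar>g (returns i m \<omega>)\<bar> \<le> (\<Sum>b\<le>m. \<bar>g b\<bar>)" for \<omega>
    by (rule member_le_sum[where f = "\<lambda>b. \<bar>g b\<bar>"]) (auto simp: returns_def return_count_le)
  then show "AE \<omega> in M. norm (g (returns i m \<omega>)) \<le> (\<Sum>b\<le>m. \<bar>g b\<bar>)" by simp
qed measurable

lemma expectation_function_of_returns_le: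
  fixes F :: "nat \<Rightarrow> real"
  assumes "\<And>b. 0 \<le> F b"
  shows "expectation (\<lambda>\<omega>. F (returns i m \<omega>)) \<le> (\<Sum>b\<le>m. F b * q ^ b)"
proof -
  \<comment> \<open>The value \<open>F b\<close> at \<open>b = N\<close> is one of the terms of the sum over all \<open>b \<le> N\<close>, so tails can replace point probabilities.\<close>
  have "F (returns i m \<omega>) \<le> (\<Sum>b\<le>m. F b * of_bool (b \<le> returns i m \<omega>))" for \<omega>
  proof -
    have "F (returns i m \<omega>) * of_bool (returns i m \<omega> \<le> returns i m \<omega>) \<le>
        (\<Sum>b\<le>m. F b * of_bool (b \<le> returns i m \<omega>))"
      by (rule member_le_sum) (use assms in \<open>auto simp: returns_def return_count_le\<close>)
    then show ?thesis by simp
  qed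
  then have "expectation (\<lambda>\<omega>. F (returns i m \<omega>)) \<le>
      expectation (\<lambda>\<omega>. \<Sum>b\<le>m. F b * of_bool (b \<le> returns i m \<omega>))"
    by (intro integral_mono function_of_returns_integrable Bochner_Integration.integrable_sum
        integrable_mult_right expectation_of_bool returns_event)
  also have "\<dots> = (\<Sum>b\<le>m. F b * returns_tail m b)"
    by (simp add: expectation_of_bool[OF returns_event] prob_returns del: sum_of_bool_mult_eq sum_mult_of_bool_eq)
  also have "\<dots> \<le> (\<Sum>b\<le>m. F b * q ^ b)"
    by (intro sum_mono mult_left_mono returns_tail_le assms)
  finally show ?thesis .
qed

lemma walk_functional_square_le:
  assumes "f 0 = 0" "\<omega> \<in> space M"
  shows "(walk_functional f n \<omega>)\<^sup>2 \<le>
    real n * (\<Sum>i<n. (f (Suc (returns i (n - 1 - i) \<omega>)))\<^sup>2 / real (Suc (returns i (n - 1 - i) \<omega>)))"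
proof -
  let ?s = "\<lambda>k. ordered_product G \<xi> k \<omega>"
  have eq: "(\<Sum>i<n. h (later_visits ?s n i)) = (\<Sum>i<n. h (returns i (n - 1 - i) \<omega>))" for h :: "nat \<Rightarrow> real"
    by (intro sum.cong refl) (simp only: later_visits_eq_returns[OF assms(2)] lessThan_iff)
  show ?thesis
    using sum_over_points_squared_le[where f = f and s = ?s and n = n, OF assms(1)]
    unfolding walk_functional_def eq[of "\<lambda>b. f (Suc b) - f b"] eq[of "\<lambda>b. (f (Suc b))\<^sup>2 / real (Suc b)"] .
qed

lemma walk_functional_square_integrable:
  assumes "f 0 = 0"
  shows "square_integrable M (walk_functional f n)"
proof -
  have [measurable]: "walk_functional f n \<in> borel_measurable M"
    unfolding walk_functional_def[abs_def] by (intro borel_measurable_sum borel_measurable_diff function_of_returns_measurable)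
  let ?B = "\<lambda>\<omega>. real n * (\<Sum>i<n. (f (Suc (returns i (n - 1 - i) \<omega>)))\<^sup>2 / real (Suc (returns i (n - 1 - i) \<omega>)))"
  have "integrable M (\<lambda>\<omega>. (walk_functional f n \<omega>)\<^sup>2)"
  proof (rule Bochner_Integration.integrable_bound)
    show "integrable M ?B"
      by (intro integrable_mult_right Bochner_Integration.integrable_sum function_of_returns_integrable)
    have "norm ((walk_functional f n \<omega>)\<^sup>2) \<le> norm (?B \<omega>)" if "\<omega> \<in> space M" for \<omega>
      using walk_functional_square_le[of f \<omega> n, OF assms that] by (smt (verit) real_norm_def zero_le_power2)
    then show "AE \<omega> in M. norm ((walk_functional f n \<omega>)\<^sup>2) \<le> norm (?B \<omega>)"
      by (rule AE_I2)
  qed measurable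
  then show ?thesis by (simp add: square_integrable_def)
qed

text \<open>The \<open>L\<^sup>2\<close> bound that controls the truncation error: the constant does not depend on \<open>n\<close>, and it
  is the weighted sum of squares whose finiteness is the hypothesis on \<open>f\<close>.\<close>

lemma walk_functional_second_moment_le:
  assumes f0: "f 0 = 0" and F: "summable (\<lambda>b. (f (Suc b))\<^sup>2 / real (Suc b) * q ^ b)"
  shows "expectation (\<lambda>\<omega>. (walk_functional f n \<omega>)\<^sup>2) \<le>
    real n * real n * (\<Sum>b. (f (Suc b))\<^sup>2 / real (Suc b) * q ^ b)"
proof -
  let ?F = "\<lambda>b. (f (Suc b))\<^sup>2 / real (Suc b)"
  let ?B = "\<lambda>\<omega>. real n * (\<Sum>i<n. ?F (returns i (n - 1 - i) \<omega>))"
  have "expectation (\<lambda>\<omega>. (walk_functional f n \<omega>)\<^sup>2) \<le> expectation ?B"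
  proof (rule integral_mono)
    show "integrable M (\<lambda>\<omega>. (walk_functional f n \<omega>)\<^sup>2)"
      using walk_functional_square_integrable[of f n, OF f0] by (simp add: square_integrable_def)
    show "integrable M ?B"
      by (intro integrable_mult_right Bochner_Integration.integrable_sum function_of_returns_integrable)
  qed (rule walk_functional_square_le[of f, OF f0])
  also have "\<dots> = real n * (\<Sum>i<n. expectation (\<lambda>\<omega>. ?F (returns i (n - 1 - i) \<omega>)))"
    by (simp only: integral_mult_right_zero Bochner_Integration.integral_sum[OF function_of_returns_integrable[of ?F]])
  also have "\<dots> \<le> real n * (\<Sum>i<n. \<Sum>b. ?F b * q ^ b)"
  proof (intro mult_left_mono sum_mono)
    fix i
    have "expectation (\<lambda>\<omega>. ?F (returns i (n - 1 - i) \<omega>)) \<le> (\<Sum>b\<le>n - 1 - i. ?F b * q ^ b)"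
      by (rule expectation_function_of_returns_le) simp
    also have "\<dots> \<le> (\<Sum>b. ?F b * q ^ b)"
      by (rule sum_le_suminf[OF F]) (use q_bounds in auto)
    finally show "expectation (\<lambda>\<omega>. ?F (returns i (n - 1 - i) \<omega>)) \<le> (\<Sum>b. ?F b * q ^ b)" .
  qed simp
  finally show ?thesis by (simp add: algebra_simps)
qed

lemma walk_functional_add:
  "walk_functional (\<lambda>j. f j + g j) n \<omega> = walk_functional f n \<omega> + walk_functional g n \<omega>"
  by (simp add: walk_functional_def sum.distrib sum_subtractf)

text \<open>The indicator of \<open>Suc j\<close> contributes the increment \<open>of_bool (b = j) - of_bool (b = Suc j)\<close>, which is
  a second difference of the indicators \<open>of_bool (a \<le> b)\<close> in \<open>a\<close>.\<close>

lemma walk_functional_truncated: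
  assumes "f 0 = 0"
  shows "walk_functional (\<lambda>j. if j \<le> K then f j else 0) n \<omega> = (\<Sum>j<K. f (Suc j) *
    (return_level j n \<omega> - 2 * return_level (Suc j) n \<omega> + return_level (Suc (Suc j)) n \<omega>))"
proof -
  have eq: "(if x \<le> K then f x else 0) = (\<Sum>j<K. f (Suc j) * of_bool (x = Suc j))" for x
  proof (cases x)
    case (Suc y)
    have "(\<Sum>j<K. f (Suc j) * of_bool (x = Suc j)) = (\<Sum>j<K. if y = j then f (Suc j) else 0)"
      by (intro sum.cong refl) (use Suc in auto)
    then show ?thesis using Suc by (simp add: Suc_le_eq)
  qed (use assms in simp)
  have diff: "(of_bool (Suc b = Suc j) :: real) - of_bool (b = Suc j) =
      of_bool (j \<le> b) - 2 * of_bool (Suc j \<le> b) + of_bool (Suc (Suc j) \<le> b)" for b j :: nat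
    by (cases b j rule: linorder_cases) (auto simp: le_less Suc_le_eq less_Suc_eq)
  have "walk_functional (\<lambda>j. if j \<le> K then f j else 0) n \<omega> =
      (\<Sum>i<n. \<Sum>j<K. f (Suc j) * (of_bool (Suc (returns i (n - 1 - i) \<omega>) = Suc j) -
         of_bool (returns i (n - 1 - i) \<omega> = Suc j)))"
    unfolding walk_functional_def eq by (simp only: sum_subtractf right_diff_distrib)
  also have "\<dots> = (\<Sum>j<K. \<Sum>i<n. f (Suc j) * (of_bool (j \<le> returns i (n - 1 - i) \<omega>) -
      2 * of_bool (Suc j \<le> returns i (n - 1 - i) \<omega>) + of_bool (Suc (Suc j) \<le> returns i (n - 1 - i) \<omega>)))"
    unfolding diff by (rule sum.swap)
  also have "\<dots> = (\<Sum>j<K. f (Suc j) *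
      (return_level j n \<omega> - 2 * return_level (Suc j) n \<omega> + return_level (Suc (Suc j)) n \<omega>))"
    unfolding return_level_def
    by (simp only: sum_distrib_left[symmetric] sum.distrib sum_subtractf)
  finally show ?thesis .
qed

lemma truncated_walk_functional_tendsto_L2:
  assumes "f 0 = 0"
  shows "tendsto_L2 M (\<lambda>n \<omega>. walk_functional (\<lambda>j. if j \<le> K then f j else 0) (Suc n) \<omega> / real (Suc n)
      - (1 - q)\<^sup>2 * (\<Sum>j<K. f (Suc j) * q ^ j)) (\<lambda>_. 0)"
proof -
  let ?Y = "\<lambda>a n \<omega>. return_level a (Suc n) \<omega> / real (Suc n) - q ^ a"
  have "tendsto_L2 M (\<lambda>n \<omega>. \<Sum>j<K. f (Suc j) *
      ((?Y j n \<omega> + (-2) * ?Y (Suc j) n \<omega>) + ?Y (Suc (Suc j)) n \<omega>)) (\<lambda>_. 0)"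
    by (intro tendsto_L2_zero_sum tendsto_L2_zero_cmult tendsto_L2_zero_add return_level_tendsto_L2
        finite_lessThan)
  also have "(\<lambda>n \<omega>. \<Sum>j<K. f (Suc j) *
      ((?Y j n \<omega> + (-2) * ?Y (Suc j) n \<omega>) + ?Y (Suc (Suc j)) n \<omega>)) =
    (\<lambda>n \<omega>. walk_functional (\<lambda>j. if j \<le> K then f j else 0) (Suc n) \<omega> / real (Suc n)
      - (1 - q)\<^sup>2 * (\<Sum>j<K. f (Suc j) * q ^ j))"
  proof (intro ext)
    fix n \<omega>
    have "f (Suc j) * ((?Y j n \<omega> + (-2) * ?Y (Suc j) n \<omega>) + ?Y (Suc (Suc j)) n \<omega>) =
        f (Suc j) * (return_level j (Suc n) \<omega> - 2 * return_level (Suc j) (Suc n) \<omega> +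
          return_level (Suc (Suc j)) (Suc n) \<omega>) / real (Suc n) - (1 - q)\<^sup>2 * (f (Suc j) * q ^ j)" for j
    proof -
      have "f (Suc j) * (((x / N - Q) + (-2) * (y / N - q * Q)) + (z / N - q * (q * Q))) =
          f (Suc j) * (x - 2 * y + z) / N - (1 - q)\<^sup>2 * (f (Suc j) * Q)" for x y z Q N :: real
        by (simp add: power2_eq_square algebra_simps add_divide_distrib diff_divide_distrib)
      then show ?thesis by (simp only: power_Suc)
    qed
    then show "(\<Sum>j<K. f (Suc j) * ((?Y j n \<omega> + (-2) * ?Y (Suc j) n \<omega>) + ?Y (Suc (Suc j)) n \<omega>)) =
        walk_functional (\<lambda>j. if j \<le> K then f j else 0) (Suc n) \<omega> / real (Suc n)
        - (1 - q)\<^sup>2 * (\<Sum>j<K. f (Suc j) * q ^ j)"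
      by (simp only: walk_functional_truncated[of f, OF assms] sum_subtractf sum_divide_distrib sum_distrib_left)
  qed
  finally show ?thesis .
qed

lemma walk_functional_tendsto_L2:
  assumes f0: "f 0 = 0" and F: "summable (\<lambda>b. (f (Suc b))\<^sup>2 / real (Suc b) * q ^ b)"
    and fq: "summable (\<lambda>b. f (Suc b) * q ^ b)"
  shows "(\<lambda>n. expectation (\<lambda>\<omega>. (walk_functional f (Suc n) \<omega> / real (Suc n) -
    (1 - q)\<^sup>2 * (\<Sum>b. f (Suc b) * q ^ b))\<^sup>2)) \<longlonglongrightarrow> 0"
proof -
  let ?F = "\<lambda>b. (f (Suc b))\<^sup>2 / real (Suc b) * q ^ b"
  \<comment> \<open>Truncation at level \<open>K\<close>: \<open>B\<close> is the centred average of the kept part and \<open>A\<close> the average of the rest.\<close>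
  define low where "low = (\<lambda>K j. if j \<le> K then f j else 0)"
  define high where "high = (\<lambda>K j. if j \<le> K then 0 else f j)"
  define L where "L = (1 - q)\<^sup>2 * (\<Sum>b. f (Suc b) * q ^ b)"
  define L' where "L' = (\<lambda>K. (1 - q)\<^sup>2 * (\<Sum>b<K. f (Suc b) * q ^ b))"
  define T where "T = (\<lambda>K. suminf ?F - (\<Sum>b<K. ?F b))"
  define A where "A = (\<lambda>K n \<omega>. walk_functional (high K) (Suc n) \<omega> / real (Suc n))"
  define B where "B = (\<lambda>K n \<omega>. walk_functional (low K) (Suc n) \<omega> / real (Suc n) - L' K)"
  have zero: "low K 0 = 0" "high K 0 = 0" for K by (simp_all add: low_def high_def f0)
  have B: "tendsto_L2 M (B K) (\<lambda>_. 0)" for K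
    unfolding B_def L'_def low_def by (rule truncated_walk_functional_tendsto_L2[of f, OF f0])
  have A: "square_integrable M (A K n)" for K n
    using square_integrable_cmult[OF walk_functional_square_integrable[of "high K" "Suc n", OF zero(2)], of "1 / real (Suc n)"]
    by (simp add: A_def)
  have L': "L' \<longlonglongrightarrow> L"
    unfolding L'_def L_def by (intro tendsto_mult_left summable_LIMSEQ fq)
  have tail: "(\<lambda>b. (high K (Suc b))\<^sup>2 / real (Suc b) * q ^ b) sums T K" for K
  proof -
    have "(\<lambda>b. ?F b - (if b \<in> {..<K} then ?F b else 0)) sums T K"
      unfolding T_def by (intro sums_diff summable_sums F sums_If_finite_set finite_lessThan)
    also have "(\<lambda>b. ?F b - (if b \<in> {..<K} then ?F b else 0)) =
        (\<lambda>b. (high K (Suc b))\<^sup>2 / real (Suc b) * q ^ b)"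
      by (auto simp: high_def fun_eq_iff)
    finally show ?thesis .
  qed
  have A_le: "expectation (\<lambda>\<omega>. (A K n \<omega>)\<^sup>2) \<le> T K" for K n
  proof -
    have "expectation (\<lambda>\<omega>. (A K n \<omega>)\<^sup>2) =
        expectation (\<lambda>\<omega>. (walk_functional (high K) (Suc n) \<omega>)\<^sup>2) / (real (Suc n))\<^sup>2"
      by (simp add: A_def power_divide)
    also have "\<dots> \<le> (real (Suc n) * real (Suc n) * T K) / (real (Suc n))\<^sup>2"
      using walk_functional_second_moment_le[of "high K" "Suc n", OF zero(2) sums_summable[OF tail]]
      by (intro divide_right_mono) (simp_all only: sums_unique[OF tail, symmetric] zero_le_power2)
    also have "\<dots> = T K" by (simp add: power2_eq_square)
    finally show ?thesis .
  qed
  have split: "walk_functional f (Suc n) \<omega> / real (Suc n) - L = A K n \<omega> + (B K n \<omega> + (L' K - L))" for K n \<omega>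
  proof -
    have "f = (\<lambda>j. high K j + low K j)" by (auto simp: high_def low_def)
    then have "walk_functional f (Suc n) \<omega> = walk_functional (high K) (Suc n) \<omega> + walk_functional (low K) (Suc n) \<omega>"
      by (metis walk_functional_add)
    then show ?thesis by (simp add: A_def B_def add_divide_distrib)
  qed
  show ?thesis
    unfolding L_def[symmetric]
  proof (rule tendsto_zero_of_two_scale_bound)
    show "(\<lambda>K. 2 * T K + 4 * (L' K - L)\<^sup>2) \<longlonglongrightarrow> 0"
    proof -
      have "(\<lambda>K. 2 * T K + 4 * (L' K - L)\<^sup>2) \<longlonglongrightarrow>
          2 * (suminf ?F - suminf ?F) + 4 * (L - L)\<^sup>2"
        unfolding T_def by (intro tendsto_intros summable_LIMSEQ F L')
      then show ?thesis by simp
    qed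
    show "(\<lambda>n. 4 * expectation (\<lambda>\<omega>. (B K n \<omega>)\<^sup>2)) \<longlonglongrightarrow> 0" for K
    proof -
      have "(\<lambda>n. 4 * expectation (\<lambda>\<omega>. (B K n \<omega>)\<^sup>2)) \<longlonglongrightarrow> 4 * 0"
        using B[of K] by (intro tendsto_mult_left) (simp add: tendsto_L2_def)
      then show ?thesis by simp
    qed
    fix n K
    have BK: "square_integrable M (B K n)" using B[of K] by (simp add: tendsto_L2_def)
    have "square_integrable M (\<lambda>\<omega>. A K n \<omega> + (B K n \<omega> + (L' K - L)))"
      by (intro square_integrable_add A BK square_integrable_const)
    then have "expectation (\<lambda>\<omega>. (A K n \<omega> + (B K n \<omega> + (L' K - L)))\<^sup>2) \<le>
        expectation (\<lambda>\<omega>. 2 * (A K n \<omega>)\<^sup>2 + (4 * (B K n \<omega>)\<^sup>2 + 4 * (L' K - L)\<^sup>2))"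
    proof (intro integral_mono)
      fix \<omega>
      show "(A K n \<omega> + (B K n \<omega> + (L' K - L)))\<^sup>2 \<le> 2 * (A K n \<omega>)\<^sup>2 + (4 * (B K n \<omega>)\<^sup>2 + 4 * (L' K - L)\<^sup>2)"
        using square_add_le[of "A K n \<omega>" "B K n \<omega> + (L' K - L)"] square_add_le[of "B K n \<omega>" "L' K - L"]
        by linarith
    qed (use A[of K n] BK in \<open>simp_all add: square_integrable_def\<close>)
    also have "\<dots> = 2 * expectation (\<lambda>\<omega>. (A K n \<omega>)\<^sup>2) +
        (4 * expectation (\<lambda>\<omega>. (B K n \<omega>)\<^sup>2) + 4 * (L' K - L)\<^sup>2)"
      using A[of K n] BK by (simp add: square_integrable_def prob_space)
    finally show "expectation (\<lambda>\<omega>. (walk_functional f (Suc n) \<omega> / real (Suc n) - L)\<^sup>2) \<le>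
        (2 * T K + 4 * (L' K - L)\<^sup>2) + 4 * expectation (\<lambda>\<omega>. (B K n \<omega>)\<^sup>2)"
      using A_le[of K n] unfolding split[of n _ K] by linarith
  qed simp
qed

end

section \<open>Mean-square convergence\<close>

text \<open>The elementary bound \<open>\<bar>x\<bar> \<le> x\<^sup>2 / k + k\<close> compares the series with the hypothesis and with the
  derivative of the geometric series.\<close>

lemma weighted_l2_imp_summable:
  fixes f :: "nat \<Rightarrow> real"
  assumes q: "0 \<le> q" "q < 1" and F: "summable (\<lambda>b. (f (Suc b))\<^sup>2 / real (Suc b) * q ^ b)"
  shows "summable (\<lambda>b. f (Suc b) * q ^ b)"
proof (rule summable_comparison_test')
  have "summable (\<lambda>b. real (Suc b) * q ^ b)"
    using geometric_deriv_sums[of q] q by (simp add: sums_iff)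
  then show "summable (\<lambda>b. (f (Suc b))\<^sup>2 / real (Suc b) * q ^ b + real (Suc b) * q ^ b)"
    by (rule summable_add[OF F])
  fix b :: nat
  have "\<bar>f (Suc b)\<bar> \<le> (f (Suc b))\<^sup>2 / real (Suc b) + real (Suc b)"
  proof (cases "\<bar>f (Suc b)\<bar> \<le> real (Suc b)")
    case False
    then have "\<bar>f (Suc b)\<bar> * real (Suc b) \<le> \<bar>f (Suc b)\<bar> * \<bar>f (Suc b)\<bar>"
      by (intro mult_left_mono) auto
    then have "\<bar>f (Suc b)\<bar> \<le> (f (Suc b))\<^sup>2 / real (Suc b)"
      by (simp add: pos_le_divide_eq power2_eq_square)
    then show ?thesis by simp
  qed (simp add: add_increasing)
  then have "\<bar>f (Suc b)\<bar> * q ^ b \<le> ((f (Suc b))\<^sup>2 / real (Suc b) + real (Suc b)) * q ^ b"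
    using q by (intro mult_right_mono) auto
  then show "norm (f (Suc b) * q ^ b) \<le> (f (Suc b))\<^sup>2 / real (Suc b) * q ^ b + real (Suc b) * q ^ b"
    using q by (simp only: real_norm_def abs_mult power_abs abs_of_nonneg distrib_right)
qed

lemma summable_weight_Suc:
  fixes c :: "nat \<Rightarrow> real"
  assumes "summable (\<lambda>j. c j * q ^ Suc j)"
  shows "summable (\<lambda>j. c j * q ^ j)"
proof (cases "q = 0")
  case True
  \<comment> \<open>As \<open>0 ^ 0 = 1\<close>, only the term at \<open>j = 0\<close> is left, which the hypothesis does not see.\<close>
  then show ?thesis by (intro summable_finite[of "{0}"]) auto
next
  case False
  have "summable (\<lambda>j. (1 / q) * (c j * q ^ Suc j))" using assms by (rule summable_mult)
  then show ?thesis using False by simp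
qed

theorem theorem2:
  fixes M :: "'w measure" and G :: "('g, 'b) monoid_scheme"
    and \<xi> S :: "nat \<Rightarrow> 'w \<Rightarrow> 'g" and f :: "nat \<Rightarrow> real" and \<gamma> :: real
  assumes "random_walk M G \<xi> S"
    and "transient M G S"
    and "\<gamma> = escape_prob M G S"
    and "f 0 = 0"
    and "summable (\<lambda>j. (f (Suc j))\<^sup>2 * (1 - \<gamma>) ^ Suc j / real (Suc j))"
  shows "summable (\<lambda>j. f (Suc j) * (1 - \<gamma>) ^ j) \<and>
    tendsto_L2 M (\<lambda>n \<omega>. local_time_functional G S f (Suc n) \<omega> / real (Suc n))
      (\<lambda>_. \<gamma>\<^sup>2 * (\<Sum>j. f (Suc j) * (1 - \<gamma>) ^ j))"
proof -
  interpret random_walk M G \<xi> S by fact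
  have q: "0 \<le> 1 - \<gamma>" "1 - \<gamma> < 1"
    using assms(2,3) q_bounds by (auto simp: transient_def)
  have F: "summable (\<lambda>b. (f (Suc b))\<^sup>2 / real (Suc b) * (1 - \<gamma>) ^ b)"
    by (rule summable_weight_Suc) (use assms(5) in \<open>simp add: mult.commute\<close>)
  have fq: "summable (\<lambda>j. f (Suc j) * (1 - \<gamma>) ^ j)"
    by (rule weighted_l2_imp_summable[OF q F])
  let ?L = "\<gamma>\<^sup>2 * (\<Sum>j. f (Suc j) * (1 - \<gamma>) ^ j)"
  let ?X = "\<lambda>n \<omega>. local_time_functional G S f (Suc n) \<omega> / real (Suc n)"
  let ?W = "\<lambda>n \<omega>. walk_functional f (Suc n) \<omega> / real (Suc n)"
  have meas [measurable]: "local_time_functional G S f (Suc n) \<in> borel_measurable M" for n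
    by (rule local_time_functional_measurable)
  have W: "square_integrable M (?W n)" for n
    using square_integrable_cmult[OF walk_functional_square_integrable[of f "Suc n"], of "1 / real (Suc n)"] assms(4)
    by simp
  then have [measurable]: "?W n \<in> borel_measurable M" for n by (simp only: square_integrable_def)
  have ae: "AE \<omega> in M. ?X n \<omega> = ?W n \<omega>" for n
    using local_time_functional_AE[of f n, OF assms(4)] by (rule AE_mp) simp
  have X: "square_integrable M (?X n)" for n
  proof -
    have "integrable M (\<lambda>\<omega>. (?X n \<omega>)\<^sup>2) \<longleftrightarrow> integrable M (\<lambda>\<omega>. (?W n \<omega>)\<^sup>2)"
    proof (rule integrable_cong_AE)
      show "AE \<omega> in M. (?X n \<omega>)\<^sup>2 = (?W n \<omega>)\<^sup>2" using ae[of n] by (rule AE_mp) simp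
    qed measurable
    then show ?thesis using W[of n] by (simp add: square_integrable_def)
  qed
  have "(\<integral>\<omega>. (?X n \<omega> - ?L)\<^sup>2 \<partial>M) = (\<integral>\<omega>. (?W n \<omega> - ?L)\<^sup>2 \<partial>M)" for n
  proof (rule integral_cong_AE)
    show "AE \<omega> in M. (?X n \<omega> - ?L)\<^sup>2 = (?W n \<omega> - ?L)\<^sup>2" using ae[of n] by (rule AE_mp) simp
  qed measurable
  moreover have "(\<lambda>n. \<integral>\<omega>. (?W n \<omega> - ?L)\<^sup>2 \<partial>M) \<longlonglongrightarrow> 0"
    using walk_functional_tendsto_L2[of f] F fq assms(3,4) by simp
  ultimately show ?thesis
    using X fq by (simp add: tendsto_L2_def square_integrable_const)
qed

end
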